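(* Let $X$ be a complete separable irreducible median space of finite rank. If $\mathrm{Isom}(X)$ acts Roller non-elementarily and Roller minimally on $X$, then there exists an $\mathrm{Isom}(X)$-invariant countable set of halfspaces of $X$ that separates any pair of distinct points of the median core of $X$.
   Context: A metric space $(X,d)$ is a median space if for all $x,y,z\in X$ the intersection $[x,y]\cap[x,z]\cap[y,z]$ is a single point $m(x,y,z)$, where $[a,b]=\{c\in X: d(a,b)=d(a,c)+d(c,b)\}$. A subset $A$ is convex if $[a,b]\subseteq A$ for all $a,b\in A$. A halfspace is a subset $\mathfrak h$ such that $\mathfrak h$ and its complement $\mathfrak h^c$ are convex; it separates two points if it contains exactly one of them. Two halfspaces are transverse if each of $\mathfrak h_1,\mathfrak h_1^c$ meets each of $\mathfrak h_2,\mathfrak h_2^c$. The rank is the maximal number of pairwise transverse halfspaces. $X$ is irreducible if it is not the $\ell^1$-product of two median spaces neither of which is a single point. Two disjoint halfspaces are strongly separated if no halfspace is transverse to both. For $X$ complete of finite rank, the Roller compactification $\bar X$ is the closure of the image of $X\to\prod_{a,b\in X}[a,b]$, $x\mapsto(m(x,a,b))_{a,b}$, in the product topology; it is a compact median algebra with coordinatewise median operation $m$, with intervals $[x,y]=\{z: m(x,y,z)=z\}$ and convexity defined via these. $X$ is identified with its image and $\partial X=\bar X\setminus X$. Isometries of $X$ extend to $\bar X$. For a halfspace $\mathfrak h$ of $X$, $\tilde{\mathfrak h}=\{x\in\bar X: m(x,a,b)\in\mathfrak h\ \forall a\in\mathfrak h, b\in\mathfrak h^c\}$. A point $x\in\partial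 X$ is regular if there is a sequence of halfspaces $(\mathfrak h_i)_{i\in\mathbb N}$ of $X$ and $r>0$ such that for all $i$: $x\in\tilde{\mathfrak h}_i$, $\mathfrak h_{i+1}\subseteq\mathfrak h_i$, and $\mathfrak h_i^c,\mathfrak h_{i+1}$ are strongly separated with $d(\mathfrak h_i^c,\mathfrak h_{i+1})>r$. The regular boundary $\partial_rX$ is the set of regular points. An isometric action on $X$ ($X$ not a single point) is Roller minimal if $\bar X$ contains no nonempty proper invariant closed convex subset, and Roller non-elementary if there is no finite orbit in $\bar X$. Median core: let $Y_0=\{m(\tilde x_1,\tilde x_2,\tilde x_3): \tilde x_1,\tilde x_2,\tilde x_3\in\partial_rX \text{ pairwise distinct}\}$, which is a subset of $X$; set $Y_{i+1}=m(Y_i,Y_i,Y_i)$ and $Y'=\bigcup_{i\in\mathbb N}Y_i$. The median core of $X$ is the closure of $Y'$ in $X$. *)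

theory Defs
  imports "HOL-Analysis.Analysis"
begin

definition separates :: "'a set \<Rightarrow> 'a \<Rightarrow> 'a \<Rightarrow> bool" where
  "separates h x y \<longleftrightarrow> (x \<in> h) \<noteq> (y \<in> h)"

locale median_space = Metric_space +
  assumes median_ex: "\<lbrakk>x \<in> M; y \<in> M; z \<in> M\<rbrakk> \<Longrightarrow>
    \<exists>p. {c \<in> M. d x y = d x c + d c y} \<inter> {c \<in> M. d x z = d x c + d c z}
        \<inter> {c \<in> M. d y z = d y c + d c z} = {p}"

context median_space
begin

definition interval :: "'a \<Rightarrow> 'a \<Rightarrow> 'a set" where
  "interval a b = {c \<in> M. d a b = d a c + d c b}"

definition med :: "'a \<Rightarrow> 'a \<Rightarrow> 'a \<Rightarrow> 'a" where
  "med x y z = the_elem (interval x y \<inter> interval x z \<inter> interval y z)"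

definition mconvex :: "'a set \<Rightarrow> bool" where
  "mconvex A \<longleftrightarrow> A \<subseteq> M \<and> (\<forall>a\<in>A. \<forall>b\<in>A. interval a b \<subseteq> A)"

definition halfspace :: "'a set \<Rightarrow> bool" where
  "halfspace h \<longleftrightarrow> h \<subseteq> M \<and> mconvex h \<and> mconvex (M - h)"

definition transverse :: "'a set \<Rightarrow> 'a set \<Rightarrow> bool" where
  "transverse h k \<longleftrightarrow> h \<inter> k \<noteq> {} \<and> h \<inter> (M - k) \<noteq> {}
     \<and> (M - h) \<inter> k \<noteq> {} \<and> (M - h) \<inter> (M - k) \<noteq> {}"

definition rank :: enat where
  "rank = (SUP F \<in> {F. finite F \<and> (\<forall>h\<in>F. halfspace h) \<and> pairwise transverse F}. enat (card F))"

definition strongly_separated :: "'a set \<Rightarrow> 'a set \<Rightarrow> bool" where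
  "strongly_separated h k \<longleftrightarrow> halfspace h \<and> halfspace k \<and> h \<inter> k = {}
     \<and> \<not> (\<exists>j. halfspace j \<and> transverse j h \<and> transverse j k)"

text \<open>The factors are quantified over subsets of the type of the points of \<^term>\<open>M\<close>, with
  arbitrary metrics. This is no restriction, since each factor embeds isometrically in the
  product as a slice; see \<open>irreducible_imp_trivial_factor\<close> below.\<close>

definition irreducible :: bool where
  "irreducible \<longleftrightarrow> \<not> (\<exists>(A :: 'a set) dA (B :: 'a set) dB f.
     median_space A dA \<and> median_space B dB \<and> (\<nexists>a. A = {a}) \<and> (\<nexists>b. B = {b})
     \<and> bij_betw f M (A \<times> B)
     \<and> (\<forall>x\<in>M. \<forall>y\<in>M. d x y = dA (fst (f x)) (fst (f y)) + dB (snd (f x)) (snd (f y))))"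

definition isom :: "('a \<Rightarrow> 'a) set" where
  "isom = {g \<in> extensional M. bij_betw g M M \<and> (\<forall>x\<in>M. \<forall>y\<in>M. d (g x) (g y) = d x y)}"

definition roller_product :: "('a \<times> 'a \<Rightarrow> 'a) topology" where
  "roller_product =
     product_topology (\<lambda>(a, b). subtopology mtopology (interval a b)) (M \<times> M)"

definition roller_embed :: "'a \<Rightarrow> 'a \<times> 'a \<Rightarrow> 'a" where
  "roller_embed x = (\<lambda>(a, b)\<in>M \<times> M. med x a b)"

definition roller :: "('a \<times> 'a \<Rightarrow> 'a) set" where
  "roller = roller_product closure_of (roller_embed ` M)"

definition roller_boundary :: "('a \<times> 'a \<Rightarrow> 'a) set" where
  "roller_boundary = roller - roller_embed ` M"

definition roller_med ::
  "('a \<times> 'a \<Rightarrow> 'a) \<Rightarrow> ('a \<times> 'a \<Rightarrow> 'a) \<Rightarrow> ('a \<times> 'a \<Rightarrow> 'a) \<Rightarrow> ('a \<times> 'a \<Rightarrow> 'a)" where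
  "roller_med x y z = (\<lambda>p\<in>M \<times> M. med (x p) (y p) (z p))"

definition roller_interval ::
  "('a \<times> 'a \<Rightarrow> 'a) \<Rightarrow> ('a \<times> 'a \<Rightarrow> 'a) \<Rightarrow> ('a \<times> 'a \<Rightarrow> 'a) set" where
  "roller_interval x y = {z \<in> roller. roller_med x y z = z}"

definition roller_convex :: "('a \<times> 'a \<Rightarrow> 'a) set \<Rightarrow> bool" where
  "roller_convex C \<longleftrightarrow> C \<subseteq> roller \<and> (\<forall>x\<in>C. \<forall>y\<in>C. roller_interval x y \<subseteq> C)"

text \<open>The extension of an isometry \<open>g\<close> to the Roller compactification: on points of \<^term>\<open>M\<close>,
  \<open>med (g x) a b = g (med x (inverse g a) (inverse g b))\<close>, and this formula for the coordinates
  is continuous; see \<open>roller_extend_embed\<close> and \<open>continuous_map_roller_extend\<close> below.\<close>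

definition roller_extend :: "('a \<Rightarrow> 'a) \<Rightarrow> ('a \<times> 'a \<Rightarrow> 'a) \<Rightarrow> ('a \<times> 'a \<Rightarrow> 'a)" where
  "roller_extend g x = (\<lambda>(a, b)\<in>M \<times> M. g (x (inv_into M g a, inv_into M g b)))"

definition roller_halfspace :: "'a set \<Rightarrow> ('a \<times> 'a \<Rightarrow> 'a) set" where
  "roller_halfspace h = {x \<in> roller. \<forall>a\<in>h. \<forall>b\<in>M - h.
     roller_med x (roller_embed a) (roller_embed b) \<in> roller_embed ` h}"

text \<open>The trivial halfspaces \<^term>\<open>{}\<close> and \<^term>\<open>M\<close> are excluded here: the
  distance is only meaningful between nonempty sets, and with the convention that the
  infimum of the empty set is infinite, the constant sequence \<^term>\<open>M\<close> would make every
  boundary point regular.\<close>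

definition regular_point :: "('a \<times> 'a \<Rightarrow> 'a) \<Rightarrow> bool" where
  "regular_point x \<longleftrightarrow> x \<in> roller_boundary \<and>
     (\<exists>(h :: nat \<Rightarrow> 'a set) r. r > 0 \<and>
       (\<forall>i. halfspace (h i) \<and> h i \<noteq> {} \<and> h i \<noteq> M \<and> x \<in> roller_halfspace (h i)
            \<and> h (Suc i) \<subseteq> h i
            \<and> strongly_separated (M - h i) (h (Suc i))
            \<and> Inf {d a b |a b. a \<in> M - h i \<and> b \<in> h (Suc i)} > r))"

definition regular_boundary :: "('a \<times> 'a \<Rightarrow> 'a) set" where
  "regular_boundary = {x. regular_point x}"

text \<open>An isometric action enters the following notions only through the set \<open>G\<close> of isometries
  by which the group acts.\<close>

definition roller_minimal :: "('a \<Rightarrow> 'a) set \<Rightarrow> bool" where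
  "roller_minimal G \<longleftrightarrow> (\<nexists>p. M = {p}) \<and>
     \<not> (\<exists>C. C \<noteq> {} \<and> C \<subset> roller \<and> (\<forall>g\<in>G. roller_extend g ` C = C)
          \<and> closedin (subtopology roller_product roller) C \<and> roller_convex C)"

definition roller_nonelementary :: "('a \<Rightarrow> 'a) set \<Rightarrow> bool" where
  "roller_nonelementary G \<longleftrightarrow>
     \<not> (\<exists>x\<in>roller. finite ((\<lambda>g. roller_extend g x) ` G))"

text \<open>Under the hypotheses of interest the median of three distinct regular points lies in the
  image of \<^term>\<open>M\<close>; the first stage is its preimage under \<^const>\<open>roller_embed\<close>.\<close>

primrec core_stage :: "nat \<Rightarrow> 'a set" where
  "core_stage 0 = {p \<in> M. \<exists>x1\<in>regular_boundary. \<exists>x2\<in>regular_boundary. \<exists>x3\<in>regular_boundary.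
     x1 \<noteq> x2 \<and> x1 \<noteq> x3 \<and> x2 \<noteq> x3 \<and> roller_embed p = roller_med x1 x2 x3}"
| "core_stage (Suc i) = {med x y z |x y z. x \<in> core_stage i \<and> y \<in> core_stage i \<and> z \<in> core_stage i}"

definition median_core :: "'a set" where
  "median_core = mtopology closure_of (\<Union>i. core_stage i)"

lemma med_eqI:
  assumes "x \<in> M" "y \<in> M" "z \<in> M" "p \<in> interval x y" "p \<in> interval x z" "p \<in> interval y z"
  shows "med x y z = p"
proof -
  obtain q where q: "interval x y \<inter> interval x z \<inter> interval y z = {q}"
    using median_ex[OF assms(1-3)] unfolding interval_def by blast
  then have "p = q" using assms(4-6) by blast
  then show ?thesis using q by (simp add: med_def)
qed

lemma med_in_interval:
  assumes "x \<in> M" "y \<in> M" "z \<in> M"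
  shows "med x y z \<in> interval x y" "med x y z \<in> interval x z" "med x y z \<in> interval y z"
proof -
  obtain q where q: "interval x y \<inter> interval x z \<inter> interval y z = {q}"
    using median_ex[OF assms] unfolding interval_def by blast
  moreover have "med x y z = q" using q by (simp add: med_def)
  ultimately show "med x y z \<in> interval x y" "med x y z \<in> interval x z" "med x y z \<in> interval y z"
    by blast+
qed

lemma isom_interval:
  assumes "g \<in> isom" "a \<in> M" "b \<in> M" "c \<in> interval a b"
  shows "g c \<in> interval (g a) (g b)"
  using assms unfolding isom_def interval_def bij_betw_def by auto

lemma isom_med:
  assumes g: "g \<in> isom" and xyz: "x \<in> M" "y \<in> M" "z \<in> M"
  shows "g (med x y z) = med (g x) (g y) (g z)"
proof -
  have "g x \<in> M" "g y \<in> M" "g z \<in> M"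
    using g xyz by (auto simp: isom_def bij_betw_def)
  then show ?thesis
    using isom_interval[OF g] med_in_interval[OF xyz] xyz by (intro med_eqI[symmetric]) auto
qed

lemma isom_inv:
  assumes "g \<in> isom" "a \<in> M"
  shows "inv_into M g a \<in> M" "g (inv_into M g a) = a"
  using assms by (auto simp: isom_def bij_betw_def intro: inv_into_into f_inv_into_f)

lemma roller_extend_embed:
  assumes g: "g \<in> isom" and x: "x \<in> M"
  shows "roller_extend g (roller_embed x) = roller_embed (g x)"
  using isom_med[OF g x] isom_inv[OF g]
  by (auto simp: roller_extend_def roller_embed_def restrict_def fun_eq_iff)

lemma topspace_roller_product: "topspace roller_product = (\<Pi>\<^sub>E (a, b)\<in>M \<times> M. interval a b)"
proof -
  have "topspace ((\<lambda>(a, b). subtopology mtopology (interval a b)) p) = (case p of (a, b) \<Rightarrow> interval a b)" for p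
    by (cases p) (auto simp: interval_def)
  then show ?thesis unfolding roller_product_def topspace_product_topology o_def by simp
qed

lemma roller_embed_in: "x \<in> M \<Longrightarrow> roller_embed x \<in> topspace roller_product"
  unfolding topspace_roller_product roller_embed_def
  by (auto simp: med_in_interval)

lemma continuous_map_isom:
  assumes "g \<in> isom" shows "continuous_map mtopology mtopology g"
proof -
  interpret Metric_space12 M d M d ..
  have "embedding_map mtopology mtopology g"
    using assms by (intro isometry_imp_embedding_map) (auto simp: isom_def bij_betw_def)
  then show ?thesis by (auto simp: embedding_map_def dest!: homeomorphic_imp_continuous_map intro: continuous_map_into_fulltopology)
qed

lemma continuous_map_roller_extend:
  assumes g: "g \<in> isom"
  shows "continuous_map roller_product roller_product (roller_extend g)"
  unfolding roller_product_def continuous_map_componentwise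
proof (intro conjI ballI)
  show "roller_extend g ` topspace (product_topology
      (\<lambda>(a, b). subtopology mtopology (interval a b)) (M \<times> M)) \<subseteq> extensional (M \<times> M)"
    by (auto simp: roller_extend_def)
next
  fix p assume "p \<in> M \<times> M"
  then obtain a b where p: "p = (a, b)" "a \<in> M" "b \<in> M" by auto
  let ?a = "inv_into M g a" and ?b = "inv_into M g b"
  note inv = isom_inv[OF g p(2)] isom_inv[OF g p(3)]
  have "continuous_map (subtopology mtopology (interval ?a ?b))
          (subtopology mtopology (interval a b)) g"
    using continuous_map_isom[OF g] isom_interval[OF g inv(1) inv(3)] inv
    by (auto simp: continuous_map_in_subtopology continuous_map_from_subtopology)
  moreover have "continuous_map roller_product
      (subtopology mtopology (interval ?a ?b)) (\<lambda>x. x (?a, ?b))"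
    using continuous_map_product_projection[of "(?a, ?b)" "M \<times> M"
        "\<lambda>(a, b). subtopology mtopology (interval a b)"] inv
    by (simp add: roller_product_def)
  ultimately have "continuous_map roller_product
      (subtopology mtopology (interval a b)) (g \<circ> (\<lambda>x. x (?a, ?b)))"
    by (rule continuous_map_compose[rotated])
  then show "continuous_map (product_topology
      (\<lambda>(a, b). subtopology mtopology (interval a b)) (M \<times> M))
      ((\<lambda>(a, b). subtopology mtopology (interval a b)) p) (\<lambda>x. roller_extend g x p)"
    using p by (simp add: roller_extend_def roller_product_def o_def)
qed

lemma roller_extend_in_roller:
  assumes g: "g \<in> isom" and x: "x \<in> roller"
  shows "roller_extend g x \<in> roller"
proof -
  have "roller_extend g ` (roller_embed ` M) \<subseteq> roller_embed ` M"
    using roller_extend_embed[OF g] g by (auto simp: isom_def bij_betw_def)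
  then show ?thesis
    using continuous_map_image_closure_subset[OF continuous_map_roller_extend[OF g]]
      closure_of_mono x unfolding roller_def by blast
qed

end

lemma median_space_transfer:
  assumes m: "median_space B dB" and u: "bij_betw u A B"
  shows "median_space A (\<lambda>x y. dB (u x) (u y))"
proof -
  interpret B: median_space B dB by fact
  have uB: "u x \<in> B" if "x \<in> A" for x using that u by (auto simp: bij_betw_def)
  have inj: "inj_on u A" using u by (simp add: bij_betw_def)
  show ?thesis
  proof
    fix x y z assume xyz: "x \<in> A" "y \<in> A" "z \<in> A"
    have S: "u ` {c \<in> A. P (u c)} = {c \<in> B. P c}" for P
      using u by (auto simp: bij_betw_def)
    let ?P = "\<lambda>c. dB (u x) (u y) = dB (u x) c + dB c (u y) \<and> dB (u x) (u z) = dB (u x) c + dB c (u z)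
      \<and> dB (u y) (u z) = dB (u y) c + dB c (u z)"
    obtain p where p: "{c \<in> B. dB (u x) (u y) = dB (u x) c + dB c (u y)}
        \<inter> {c \<in> B. dB (u x) (u z) = dB (u x) c + dB c (u z)}
        \<inter> {c \<in> B. dB (u y) (u z) = dB (u y) c + dB c (u z)} = {p}"
      using B.median_ex[OF uB uB uB, OF xyz] by blast
    then have "{c \<in> B. ?P c} = {p}" by blast
    then have "u ` {c \<in> A. ?P (u c)} = {p}" by (subst S)
    then obtain q where "q \<in> {c \<in> A. ?P (u c)}" "u q = p" by blast
    moreover have "c = q" if "c \<in> {c \<in> A. ?P (u c)}" for c
    proof -
      have "u c = u q" using that \<open>u ` _ = {p}\<close> \<open>u q = p\<close> by blast
      then show ?thesis using inj that \<open>q \<in> _\<close> by (auto dest: inj_onD)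
    qed
    ultimately have "{c \<in> A. ?P (u c)} = {q}" by blast
    then show "\<exists>p. {c \<in> A. dB (u x) (u y) = dB (u x) (u c) + dB (u c) (u y)}
        \<inter> {c \<in> A. dB (u x) (u z) = dB (u x) (u c) + dB (u c) (u z)}
        \<inter> {c \<in> A. dB (u y) (u z) = dB (u y) (u c) + dB (u c) (u z)} = {p}"
      by (intro exI[of _ q]) auto
  qed (use inj uB B.triangle in \<open>auto simp: B.commute inj_on_def\<close>)
qed

lemma irreducible_imp_trivial_factor:
  fixes M :: "'a set" and B :: "'b set" and C :: "'c set"
  assumes "median_space M d" and irr: "median_space.irreducible M d"
    and B: "median_space B dB" and C: "median_space C dC"
    and f: "bij_betw f M (B \<times> C)"
    and l1: "\<And>x y. x \<in> M \<Longrightarrow> y \<in> M \<Longrightarrow>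
      d x y = dB (fst (f x)) (fst (f y)) + dC (snd (f x)) (snd (f y))"
  shows "(\<exists>b. B = {b}) \<or> (\<exists>c. C = {c})"
proof (rule ccontr)
  interpret median_space M d by fact
  assume neg: "\<not> ?thesis"
  show False
  proof (cases "M = {}")
    case True
    have "median_space ({} :: 'a set) (\<lambda>x y. 0)" by unfold_locales auto
    then have "\<not> irreducible"
      unfolding irreducible_def not_not
      by (intro exI[of _ "{} :: 'a set"] exI[of _ "\<lambda>x y. 0"] exI[of _ "\<lambda>x. (x, x)"])
        (simp add: True bij_betw_def)
    then show False using irr by contradiction
  next
    case False
    then obtain x where "f x \<in> B \<times> C" using f by (auto simp: bij_betw_def)
    then obtain b0 c0 where bc: "b0 \<in> B" "c0 \<in> C" by (auto simp: mem_Times_iff)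
    define k where "k = inv_into M f"
    have k: "bij_betw k (B \<times> C) M" and fk: "\<And>q. q \<in> B \<times> C \<Longrightarrow> f (k q) = q"
      using f by (auto simp: k_def bij_betw_inv_into bij_betw_inv_into_right)
    define \<beta> where "\<beta> = (\<lambda>b. k (b, c0))"
    define \<gamma> where "\<gamma> = (\<lambda>c. k (b0, c))"
    have injs: "inj_on \<beta> B" "inj_on \<gamma> C"
      using k bc by (auto simp: \<beta>_def \<gamma>_def bij_betw_def inj_on_def)
    define u where "u = inv_into B \<beta>"
    define v where "v = inv_into C \<gamma>"
    have u: "bij_betw u (\<beta> ` B) B" and v: "bij_betw v (\<gamma> ` C) C"
      using injs bij_betw_inv_into[of \<beta> B "\<beta> ` B"] bij_betw_inv_into[of \<gamma> C "\<gamma> ` C"]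
      by (simp_all add: u_def v_def inj_on_imp_bij_betw)
    have uv: "\<And>b. b \<in> B \<Longrightarrow> u (\<beta> b) = b" "\<And>c. c \<in> C \<Longrightarrow> v (\<gamma> c) = c"
      using injs by (auto simp: u_def v_def)
    let ?A = "\<beta> ` B" and ?D = "\<gamma> ` C"
    let ?F = "map_prod \<beta> \<gamma> \<circ> f"
    have 1: "median_space ?A (\<lambda>x y. dB (u x) (u y))" "median_space ?D (\<lambda>x y. dC (v x) (v y))"
      using median_space_transfer[OF B u] median_space_transfer[OF C v] by auto
    have sing: "\<exists>s. S = {s}" if "inj_on h S" "h ` S = {t}" for S t and h :: "'z \<Rightarrow> 'a"
    proof -
      from that obtain s where "s \<in> S" by blast
      moreover have "S \<subseteq> {s}" if "s \<in> S" for s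
        using \<open>inj_on h S\<close> \<open>h ` S = {t}\<close> that by (metis imageI inj_onD singletonD singletonI subsetI)
      ultimately show ?thesis by blast
    qed
    have 2: "\<nexists>a. ?A = {a}" "\<nexists>a. ?D = {a}"
      using neg sing[OF injs(1)] sing[OF injs(2)] by blast+
    have 3: "bij_betw ?F M (?A \<times> ?D)"
      using injs by (intro bij_betw_trans[OF f] bij_betw_map_prod) (auto simp: bij_betw_def)
    have 4: "d x y = dB (u (fst (?F x))) (u (fst (?F y))) + dC (v (snd (?F x))) (v (snd (?F y)))"
      if "x \<in> M" "y \<in> M" for x y
    proof -
      have "f x \<in> B \<times> C" "f y \<in> B \<times> C" using f that by (auto simp: bij_betw_def)
      then show ?thesis using l1[OF that] uv by (auto simp: mem_Times_iff)
    qed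
    have "\<not> irreducible"
      unfolding irreducible_def not_not
      by (rule exI[of _ ?A], rule exI[of _ "\<lambda>x y. dB (u x) (u y)"], rule exI[of _ ?D],
          rule exI[of _ "\<lambda>x y. dC (v x) (v y)"], rule exI[of _ ?F])
        (intro conjI ballI 1 2 3 4)
    then show False using irr by contradiction
  qed
qed

end

theory Submission
  imports Defs
begin

text \<open>Balls cut out canonical halfspaces, and these are enough. Fix a point \<open>p\<close> of a separable median
space of finite rank. Two distinct maximal halfspaces avoiding a ball around \<open>p\<close> are transverse as
soon as they share a point \<open>q\<close>: both contain \<open>q\<close>, both miss \<open>p\<close>, and neither contains the other.
Finite rank therefore leaves finitely many of them through each \<open>q\<close>, and separability leaves
countably many with nonempty interior when the radius runs over the rationals. This family,
\<open>distance_walls p\<close> below, is transported by isometries along with \<open>p\<close>, and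
\<open>distance_walls_separate\<close> shows that it separates any two distinct points \<open>x\<close>, \<open>y\<close>. Indeed one of them,
say \<open>y\<close>, differs from the median \<open>m\<close> of \<open>p\<close>, \<open>x\<close>, \<open>y\<close>, and finite rank provides a halfspace \<open>h\<^sub>0\<close> that
contains a ball around \<open>y\<close> and misses a ball around \<open>m\<close> (\<open>halfspace_between_balls\<close>). Enlarge \<open>h\<^sub>0\<close> to a
maximal halfspace \<open>h\<close> avoiding a ball around \<open>p\<close> of radius just below the distance from \<open>p\<close> to \<open>h\<^sub>0\<close>.
If \<open>h\<close> contained \<open>x\<close>, it would contain \<open>m\<close>. Take \<open>q\<close> in \<open>h\<^sub>0\<close> almost nearest to \<open>p\<close>; the median of \<open>p\<close>,
\<open>q\<close>, \<open>m\<close> lies in \<open>h\<close>, so it is almost as far from \<open>p\<close> as \<open>q\<close> and hence close to \<open>q\<close>. Since \<open>m\<close> lies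
between that median and \<open>y\<close>, it is close to a point between \<open>q\<close> and \<open>y\<close>, which is a point of \<open>h\<^sub>0\<close>; but
\<open>h\<^sub>0\<close> misses a ball around \<open>m\<close>.

It remains to find a countable set of points that is invariant under all isometries and is
nonempty when the median core is; \<open>anchors\<close> is such a set. A point of the first stage of the core
is the median of three distinct regular points, each with its chain of halfspaces. If the three
chains decrease strictly, they leave every point of the space, so they eventually have disjoint
members, and strong separation makes the median constant on the product of three deep members
(\<open>strongly_separated_med\<close>). That constant is then the value of the median on a product of three
balls, and a separable space has only countably many values of this kind. The definition of a
regular point also allows \<open>h (Suc i) = h i\<close>. Then \<open>h i\<close> is transverse to no halfspace and lies at
positive distance from its complement, so by completeness there are points \<open>p\<close> and \<open>q\<close> on its two
sides such that every passage from one side to the other goes through both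
(\<open>bridge_of_isolated_halfspace\<close>). Different such points \<open>p\<close> cannot come from pairs that are close
in comparison with their lengths, so there are again countably many. Both kinds of points are
described by the metric alone, which makes the set invariant.

Everything rests on the theorem \<open>separating_halfspace\<close> that distinct points of a median space are
separated by a halfspace. It is derived from the metric axioms: intervals are convex and gated,
projection to an interval preserves betweenness, and Zorn's lemma gives a maximal convex set that
contains one point and not the other.\<close>

context median_space
begin

section \<open>Intervals and gates\<close>

lemma interval_commute: "interval a b = interval b a"
  by (auto simp: interval_def commute add.commute)

lemma interval_subset: "c \<in> interval a b \<Longrightarrow> c \<in> M"
  by (simp add: interval_def)

lemma interval_ends: "\<lbrakk>a \<in> M; b \<in> M\<rbrakk> \<Longrightarrow> a \<in> interval a b" "\<lbrakk>a \<in> M; b \<in> M\<rbrakk> \<Longrightarrow> b \<in> interval a b"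
  by (simp_all add: interval_def)

lemma interval_self: "a \<in> M \<Longrightarrow> interval a a = {a}"
  using nonneg by (auto simp: interval_def commute add_nonneg_eq_0_iff)

lemma between_trans:
  assumes "a \<in> M" "b \<in> M" "c \<in> interval a b" "e \<in> interval a c"
  shows "e \<in> interval a b" "c \<in> interval e b"
proof -
  have "c \<in> M" "e \<in> M" using assms by (auto simp: interval_def)
  then have "d e b \<le> d e c + d c b" "d a b \<le> d a e + d e b"
    using assms by (auto intro: triangle)
  then show "e \<in> interval a b" "c \<in> interval e b"
    using assms by (auto simp: interval_def)
qed

lemma between_antisym:
  assumes "a \<in> M" "b \<in> interval a c" "c \<in> interval a b"
  shows "b = c"
proof -
  have "b \<in> M" "c \<in> M" "d b c + d c b = 0"
    using assms by (auto simp: interval_def)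
  then show ?thesis using nonneg[of b c] nonneg[of c b] by (simp add: commute)
qed

lemma med_closed: "\<lbrakk>x \<in> M; y \<in> M; z \<in> M\<rbrakk> \<Longrightarrow> med x y z \<in> M"
  using med_in_interval(1) interval_subset by blast

lemma med_perm:
  assumes "x \<in> M" "y \<in> M" "z \<in> M"
  shows "med y x z = med x y z" "med x z y = med x y z"
  using assms med_in_interval[OF assms] by (auto intro!: med_eqI simp: interval_commute)

lemma med_eq_between: "\<lbrakk>x \<in> M; y \<in> M; z \<in> interval x y\<rbrakk> \<Longrightarrow> med x y z = z"
  by (intro med_eqI) (auto simp: interval_subset interval_ends)

text \<open>The median \<open>med a b x\<close> is the gate of \<open>x\<close> in the interval from \<open>a\<close> to \<open>b\<close>: from every point of that
interval one can reach \<open>x\<close> through it. To see this for \<open>u\<close>, project \<open>x\<close> to the part between \<open>a\<close> and \<open>u\<close>,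
obtaining \<open>l\<close>, and then to the part between \<open>l\<close> and \<open>b\<close>; transitivity of betweenness identifies the
result with \<open>med a b x\<close>.\<close>

lemma gate:
  assumes "a \<in> M" "b \<in> M" "x \<in> M" "u \<in> interval a b"
  shows "med a b x \<in> interval u x"
proof -
  have u: "u \<in> M" using assms interval_subset by blast
  define l where "l = med a u x"
  have l: "l \<in> interval a u" "l \<in> interval a x" "l \<in> interval u x" "l \<in> M"
    using med_in_interval[of a u x] assms u by (auto simp: l_def med_closed)
  have lab: "l \<in> interval a b" using between_trans assms l by blast
  define n where "n = med l b x"
  have n: "n \<in> interval l b" "n \<in> interval l x" "n \<in> interval b x" "n \<in> M"
    using med_in_interval[of l b x] assms l by (auto simp: n_def med_closed)
  have "n \<in> interval a b"
    using between_trans(1)[of b a l n] assms lab n by (simp add: interval_commute)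
  moreover have "n \<in> interval a x"
    using between_trans(1)[of x a l n] assms l n by (simp add: interval_commute)
  ultimately have "med a b x = n"
    using assms n by (intro med_eqI) auto
  moreover have "n \<in> interval u x"
    using between_trans(1)[of x u l n] assms u l n by (simp add: interval_commute)
  ultimately show ?thesis by simp
qed

text \<open>If \<open>w\<close> lies between two points \<open>u\<close>, \<open>v\<close> of an interval, then the gate of \<open>w\<close> lies on the way from
\<open>w\<close> both to \<open>u\<close> and to \<open>v\<close>; a detour on both sides would contradict \<open>w\<close> being between them.\<close>

lemma interval_convex: assumes "a \<in> M" "b \<in> M" shows "mconvex (interval a b)"
  unfolding mconvex_def
proof (intro conjI ballI subsetI)
  fix u v w assume u: "u \<in> interval a b" and v: "v \<in> interval a b" and w: "w \<in> interval u v"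
  have M: "u \<in> M" "v \<in> M" "w \<in> M" using u v w interval_subset by auto
  let ?w = "med a b w"
  have g: "?w \<in> interval u w" "?w \<in> interval v w"
    using gate assms M u v by auto
  have "?w \<in> M" using assms M by (simp add: med_closed)
  then have "d u v \<le> d u ?w + d ?w v" using M triangle by blast
  moreover have "d u w = d u ?w + d ?w w" "d w v = d ?w v + d ?w w" "d u v = d u w + d w v"
    using g w by (simp_all add: interval_def commute)
  ultimately have "d ?w w = 0" using nonneg[of ?w w] by linarith
  then have "?w = w" using M \<open>?w \<in> M\<close> by simp
  then show "w \<in> interval a b" using med_in_interval(1)[of a b w] assms M by simp
qed (use interval_subset in auto)

text \<open>Projection to an interval preserves betweenness. Let \<open>p\<close>, \<open>q\<close>, \<open>r\<close> be the projections of \<open>u\<close>, \<open>v\<close>, \<open>w\<close>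
and let \<open>s\<close> be the median of \<open>p\<close>, \<open>q\<close>, \<open>r\<close>. Then \<open>s\<close> lies between \<open>r\<close> and each of \<open>u\<close>, \<open>v\<close>, so \<open>r\<close> and \<open>s\<close>
have the same gate in the interval from \<open>u\<close> to \<open>v\<close>, and going from \<open>w\<close> to \<open>r\<close> one meets \<open>s\<close>. But \<open>r\<close> is
also met on the way from \<open>s\<close> to \<open>w\<close>, so \<open>r = s\<close>.\<close>

lemma gate_between:
  assumes "a \<in> M" "b \<in> M" "u \<in> M" "v \<in> M" "w \<in> interval u v"
  shows "med a b w \<in> interval (med a b u) (med a b v)"
proof -
  have w: "w \<in> M" using assms interval_subset by blast
  define p q r where "p = med a b u" and "q = med a b v" and "r = med a b w"
  have I: "p \<in> interval a b" "q \<in> interval a b" "r \<in> interval a b"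
    using assms w med_in_interval by (auto simp: p_def q_def r_def)
  have M: "p \<in> M" "q \<in> M" "r \<in> M" using I interval_subset by auto
  define s where "s = med p q r"
  have s: "s \<in> interval p q" "s \<in> interval p r" "s \<in> interval q r" "s \<in> M"
    using med_in_interval[OF M] M by (auto simp: s_def med_closed)
  have sI: "s \<in> interval a b" using interval_convex I s assms unfolding mconvex_def by blast
  have 1: "s \<in> interval r u"
  proof -
    have "p \<in> interval r u" unfolding p_def using gate assms I by auto
    then show ?thesis using between_trans(1)[of r u p s] s M assms by (simp add: interval_commute)
  qed
  have 2: "s \<in> interval r v"
  proof -
    have "q \<in> interval r v" unfolding q_def using gate assms I by auto
    then show ?thesis using between_trans(1)[of r v q s] s M assms by (simp add: interval_commute)
  qed
  have 3: "r \<in> interval s w" unfolding r_def using gate assms sI w by auto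
  let ?k = "med u v s"
  note k = med_in_interval[of u v s, OF assms(3,4) s(4)]
  have kM: "?k \<in> M" using assms s by (simp add: med_closed)
  have "?k \<in> interval u r" "s \<in> interval ?k r"
    using between_trans[of u r s ?k] 1 k assms M by (simp_all add: interval_commute)
  moreover have "?k \<in> interval v r"
    using between_trans(1)[of v r s ?k] 2 k assms M by (simp add: interval_commute)
  ultimately have "med u v r = ?k" using k assms M by (intro med_eqI) auto
  then have "?k \<in> interval w r" using gate[of u v r w] assms M by simp
  then have "s \<in> interval w r"
    using between_trans(1)[of r w ?k s] \<open>s \<in> interval ?k r\<close> M w by (simp add: interval_commute)
  then have "s = r" using between_antisym[of w s r] 3 w by (simp add: interval_commute)
  then show ?thesis using s(1) by (simp add: p_def q_def r_def)
qed

text \<open>Add up the two gate equations for \<open>x\<close> and \<open>y\<close>, each seen from the projection of the other point.\<close>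

lemma med_lipschitz:
  assumes "a \<in> M" "b \<in> M" "x \<in> M" "y \<in> M"
  shows "d (med a b x) (med a b y) \<le> d x y"
proof -
  let ?x = "med a b x" and ?y = "med a b y"
  have I: "?x \<in> interval a b" "?y \<in> interval a b" using assms med_in_interval by auto
  then have "?x \<in> interval ?y x" "?y \<in> interval ?x y" "?x \<in> M" "?y \<in> M"
    using gate assms interval_subset by auto
  moreover from this have "d ?y x \<le> d ?y y + d y x" "d ?x y \<le> d ?x x + d x y"
    using triangle assms by auto
  moreover have "d ?y ?x = d ?x ?y" "d y x = d x y" by (simp_all add: commute)
  ultimately show ?thesis by (simp add: interval_def)
qed

section \<open>Separation of points by halfspaces\<close>

lemma med_convex:
  assumes "mconvex C" "x \<in> C" "y \<in> C" "z \<in> M"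
  shows "med x y z \<in> C"
  using assms med_in_interval(1)[of x y z] unfolding mconvex_def by blast

text \<open>In the interval from \<open>w\<close> to \<open>c\<close>, let \<open>k\<close> be the gate of \<open>z = med x y w\<close>. The projection to the
interval from \<open>w\<close> to \<open>k\<close> sends \<open>x\<close>, \<open>y\<close> and \<open>c\<close> to \<open>k\<close>, hence also \<open>u\<close> and \<open>v\<close>, hence also \<open>w\<close>. So \<open>w = k\<close>,
which puts \<open>w\<close> between \<open>c\<close> and the point \<open>z\<close> of \<open>C\<close>.\<close>

lemma convex_join:
  assumes C: "mconvex C" and c: "c \<in> M"
  shows "mconvex (\<Union>x\<in>C. interval x c)"
  unfolding mconvex_def
proof (intro conjI ballI subsetI)
  fix u v w assume "u \<in> (\<Union>x\<in>C. interval x c)" "v \<in> (\<Union>x\<in>C. interval x c)" and w: "w \<in> interval u v"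
  then obtain x y where x: "x \<in> C" "u \<in> interval x c" and y: "y \<in> C" "v \<in> interval y c" by auto
  have M: "x \<in> M" "y \<in> M" "u \<in> M" "v \<in> M" "w \<in> M"
    using C x y w unfolding mconvex_def by (auto simp: interval_subset)
  define z where "z = med x y w"
  have z: "z \<in> C" "z \<in> M" using med_convex[OF C x(1) y(1) M(5)] M by (auto simp: z_def med_closed)
  have zI: "z \<in> interval w x" "z \<in> interval w y"
    using med_in_interval[of x y w] M by (auto simp: z_def interval_commute)
  define k where "k = med w c z"
  have k: "k \<in> interval w c" "k \<in> interval w z" "k \<in> interval c z" "k \<in> M"
    using med_in_interval[of w c z] M z c by (auto simp: k_def med_closed)
  have "k \<in> interval w x" "k \<in> interval w y" using between_trans(1) k zI M by blast+
  then have p: "med w k x = k" "med w k y = k" "med w k c = k"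
    using k M c by (auto intro!: med_eqI simp: interval_ends interval_commute)
  have "med w k u = k"
    using gate_between[of w k x c u] p k M c x by (simp add: interval_self)
  moreover have "med w k v = k"
    using gate_between[of w k y c v] p k M c y by (simp add: interval_self)
  ultimately have "med w k w = k"
    using gate_between[of w k u v w] k M w by (simp add: interval_self)
  moreover have "med w k w = w" using k M by (simp add: med_eq_between interval_ends)
  ultimately have "w \<in> interval z c" using k by (simp add: interval_commute)
  then show "w \<in> (\<Union>x\<in>C. interval x c)" using z by blast
qed (use interval_subset in auto)

text \<open>The Pasch-type configuration behind the separation theorem: when \<open>x\<close>, \<open>x'\<close> and \<open>e\<close> lie in a convex
set, so does \<open>a\<close>. The proof projects to the interval from \<open>a\<close> to the median \<open>k\<close> of \<open>a\<close>, \<open>med x x' a\<close>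
and \<open>e\<close>: there \<open>c\<close> and \<open>c'\<close> go to \<open>a\<close>, hence so does \<open>e\<close>; but \<open>e\<close> goes to \<open>k\<close>, so \<open>k = a\<close>.\<close>

lemma between_of_join:
  assumes M: "x \<in> M" "x' \<in> M" "c \<in> M" "c' \<in> M"
    and a: "a \<in> interval x c" "a \<in> interval x' c'" and e: "e \<in> interval c c'"
  shows "a \<in> interval (med x x' a) e"
proof -
  have aM: "a \<in> M" "e \<in> M" using a e interval_subset by auto
  define y where "y = med x x' a"
  have y: "y \<in> interval a x" "y \<in> interval a x'" "y \<in> M"
    using med_in_interval[of x x' a] M aM by (auto simp: y_def interval_commute med_closed)
  define k where "k = med a y e"
  have k: "k \<in> interval a y" "k \<in> interval a e" "k \<in> interval y e" "k \<in> M"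
    using med_in_interval[of a y e] y aM by (auto simp: k_def med_closed)
  have "k \<in> interval a x" "k \<in> interval a x'" using between_trans(1) k y aM M by blast+
  then have "a \<in> interval k c" "a \<in> interval k c'"
    using between_trans(2)[of x c a k] between_trans(2)[of x' c' a k] a M
    by (simp_all add: interval_commute)
  then have "med a k c = a" "med a k c' = a"
    using k M aM by (auto intro!: med_eqI simp: interval_ends)
  then have "med a k e = a"
    using gate_between[of a k c c' e] k M aM e by (simp add: interval_self)
  moreover have "med a k e = k"
    using k aM by (auto intro!: med_eqI simp: interval_ends)
  ultimately show ?thesis using k by (simp add: y_def)
qed

lemma mconvex_chain_Union:
  assumes "subset.chain S \<C>" "\<And>C. C \<in> \<C> \<Longrightarrow> mconvex C"
  shows "mconvex (\<Union>\<C>)"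
  unfolding mconvex_def
proof (intro conjI ballI)
  fix a b assume "a \<in> \<Union>\<C>" "b \<in> \<Union>\<C>"
  then obtain A B where AB: "A \<in> \<C>" "a \<in> A" "B \<in> \<C>" "b \<in> B" by auto
  then have "A \<subseteq> B \<or> B \<subseteq> A" using assms(1) by (auto simp: subset_chain_def)
  then obtain C where "C \<in> \<C>" "a \<in> C" "b \<in> C" using AB by blast
  then show "interval a b \<subseteq> \<Union>\<C>" using assms(2) unfolding mconvex_def by blast
qed (use assms(2) in \<open>auto simp: mconvex_def\<close>)

text \<open>The complement of a convex set \<open>C\<close> that is maximal among those containing \<open>b\<close> but not \<open>a\<close> is convex:
by maximality and \<open>convex_join\<close>, every point \<open>c\<close> outside \<open>C\<close> is joined to \<open>C\<close> through \<open>a\<close>, and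
\<open>between_of_join\<close> prevents the interval between two such points from meeting \<open>C\<close>.\<close>

theorem separating_halfspace:
  assumes a: "a \<in> M" and b: "b \<in> M" and ab: "a \<noteq> b"
  obtains h where "halfspace h" "b \<in> h" "a \<notin> h"
proof -
  let ?S = "{C. mconvex C \<and> b \<in> C \<and> a \<notin> C}"
  have 1: "mconvex {b}" using b by (auto simp: mconvex_def interval_self)
  have "\<exists>C\<in>?S. \<forall>X\<in>?S. C \<subseteq> X \<longrightarrow> X = C"
  proof (rule subset_Zorn_nonempty)
    show "?S \<noteq> {}" using 1 ab by blast
    fix \<C> assume "\<C> \<noteq> {}" and ch: "subset.chain ?S \<C>"
    then have "mconvex (\<Union>\<C>)" by (intro mconvex_chain_Union[OF ch]) (auto simp: subset_chain_def)
    then show "\<Union>\<C> \<in> ?S" using ch \<open>\<C> \<noteq> {}\<close> by (auto simp: subset_chain_def)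
  qed
  then obtain C where C: "mconvex C" "b \<in> C" "a \<notin> C"
    and max: "\<And>X. mconvex X \<Longrightarrow> b \<in> X \<Longrightarrow> a \<notin> X \<Longrightarrow> C \<subseteq> X \<Longrightarrow> X = C" by auto
  have CM: "C \<subseteq> M" using C by (simp add: mconvex_def)
  \<comment> \<open>otherwise the join of \<open>C\<close> and \<open>c\<close> would be a larger convex set without \<open>a\<close>\<close>
  have key: "\<exists>x\<in>C. a \<in> interval x c" if "c \<in> M - C" for c
  proof (rule ccontr)
    assume neg: "\<not> ?thesis"
    let ?J = "\<Union>x\<in>C. interval x c"
    have "x \<in> interval x c" "c \<in> interval x c" if "x \<in> C" for x
      using CM that \<open>c \<in> M - C\<close> interval_ends by blast+
    then have "C \<subseteq> ?J" "c \<in> ?J" using C by blast+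
    moreover have "mconvex ?J" using convex_join C that by simp
    ultimately show False using max[of ?J] neg C that by blast
  qed
  have "mconvex (M - C)"
    unfolding mconvex_def
  proof (intro conjI ballI subsetI)
    fix c c' e assume c: "c \<in> M - C" "c' \<in> M - C" and e: "e \<in> interval c c'"
    obtain x x' where x: "x \<in> C" "a \<in> interval x c" "x' \<in> C" "a \<in> interval x' c'" using key c by blast
    then have "a \<in> interval (med x x' a) e" using between_of_join CM c e by blast
    moreover have "med x x' a \<in> C" using med_convex C x a by blast
    ultimately have "e \<notin> C" using C unfolding mconvex_def by blast
    then show "e \<in> M - C" using e interval_subset by blast
  qed auto
  then have "halfspace C" using C CM by (simp add: halfspace_def)
  then show ?thesis using that C by blast
qed

lemma halfspace_subset: "halfspace h \<Longrightarrow> h \<subseteq> M"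
  by (simp add: halfspace_def)

lemma halfspace_compl: "halfspace h \<Longrightarrow> halfspace (M - h)"
  by (auto simp: halfspace_def double_diff)

lemma halfspace_between: "\<lbrakk>halfspace h; a \<in> h; b \<in> h; c \<in> interval a b\<rbrakk> \<Longrightarrow> c \<in> h"
  unfolding halfspace_def mconvex_def by blast

lemma halfspace_between_compl:
  "\<lbrakk>halfspace h; a \<in> M; b \<in> M; a \<notin> h; b \<notin> h; c \<in> interval a b\<rbrakk> \<Longrightarrow> c \<notin> h"
  unfolding halfspace_def mconvex_def by blast

lemma interval_le: "c \<in> interval a b \<Longrightarrow> d a c \<le> d a b"
  by (simp add: interval_def)

text \<open>Medians are majority votes on halfspaces. Together with \<open>separating_halfspace\<close>, this reduces
identities between medians to propositional logic.\<close>

lemma halfspace_med: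
  assumes h: "halfspace h" and M: "x \<in> M" "y \<in> M" "z \<in> M"
  shows "med x y z \<in> h \<longleftrightarrow> (x \<in> h \<and> y \<in> h) \<or> (x \<in> h \<and> z \<in> h) \<or> (y \<in> h \<and> z \<in> h)"
proof -
  note I = med_in_interval[OF M]
  note inside = halfspace_between[OF h _ _ I(1)] halfspace_between[OF h _ _ I(2)]
    halfspace_between[OF h _ _ I(3)]
  note outside = halfspace_between_compl[OF h M(1,2) _ _ I(1)]
    halfspace_between_compl[OF h M(1,3) _ _ I(2)] halfspace_between_compl[OF h M(2,3) _ _ I(3)]
  show ?thesis using inside outside by blast
qed

section \<open>Maximal halfspaces avoiding a set\<close>

definition maximal_avoiding :: "'a set \<Rightarrow> 'a set set" where
  "maximal_avoiding U = {h. halfspace h \<and> h \<inter> U = {} \<and>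
     (\<forall>k. halfspace k \<and> k \<inter> U = {} \<and> h \<subseteq> k \<longrightarrow> k = h)}"

lemma maximal_avoidingD:
  "h \<in> maximal_avoiding U \<Longrightarrow> halfspace h" "h \<in> maximal_avoiding U \<Longrightarrow> h \<inter> U = {}"
  "\<lbrakk>h \<in> maximal_avoiding U; halfspace k; k \<inter> U = {}; h \<subseteq> k\<rbrakk> \<Longrightarrow> k = h"
  unfolding maximal_avoiding_def by blast+

lemma maximal_avoidingI:
  "\<lbrakk>halfspace h; h \<inter> U = {}; \<And>k. \<lbrakk>halfspace k; k \<inter> U = {}; h \<subseteq> k\<rbrakk> \<Longrightarrow> k = h\<rbrakk>
    \<Longrightarrow> h \<in> maximal_avoiding U"
  unfolding maximal_avoiding_def by blast

lemma maximal_avoiding_exists: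
  assumes h: "halfspace h" "h \<inter> U = {}"
  obtains k where "k \<in> maximal_avoiding U" "h \<subseteq> k"
proof -
  let ?S = "{k. halfspace k \<and> k \<inter> U = {} \<and> h \<subseteq> k}"
  have "\<exists>k\<in>?S. \<forall>X\<in>?S. k \<subseteq> X \<longrightarrow> X = k"
  proof (rule subset_Zorn_nonempty)
    show "?S \<noteq> {}" using h by blast
    fix \<C> assume "\<C> \<noteq> {}" and ch: "subset.chain ?S \<C>"
    have \<C>: "\<And>k. k \<in> \<C> \<Longrightarrow> halfspace k \<and> k \<inter> U = {} \<and> h \<subseteq> k"
      using ch by (auto simp: subset_chain_def)
    have "mconvex (\<Union>\<C>)"
      by (intro mconvex_chain_Union[OF ch]) (use \<C> in \<open>auto simp: halfspace_def\<close>)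
    moreover have "mconvex (M - \<Union>\<C>)"
      unfolding mconvex_def
    proof (intro conjI ballI subsetI)
      fix a b c assume "a \<in> M - \<Union>\<C>" "b \<in> M - \<Union>\<C>" "c \<in> interval a b"
      then have "c \<notin> k" if "k \<in> \<C>" for k
        using halfspace_between_compl[of k a b c] \<C> that by blast
      then show "c \<in> M - \<Union>\<C>" using \<open>c \<in> interval a b\<close> interval_subset by blast
    qed auto
    ultimately have "halfspace (\<Union>\<C>)" by (simp add: halfspace_def mconvex_def)
    then show "\<Union>\<C> \<in> ?S" using \<C> \<open>\<C> \<noteq> {}\<close> by blast
  qed
  then obtain k where k: "k \<in> ?S" and max: "\<forall>X\<in>?S. k \<subseteq> X \<longrightarrow> X = k" by (rule bexE)
  have "X = k" if "halfspace X" "X \<inter> U = {}" "k \<subseteq> X" for X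
  proof -
    have "X \<in> ?S" using that k by auto
    then show ?thesis using max that(3) by blast
  qed
  then have "k \<in> maximal_avoiding U" using k by (simp add: maximal_avoiding_def)
  then show ?thesis using that[of k] k by simp
qed

text \<open>Two different maximal halfspaces that contain \<open>q\<close> and avoid \<open>u\<close> are not nested, hence transverse.\<close>

lemma finite_maximal_avoiding:
  assumes N: "rank \<le> enat N" and u: "u \<in> U" "u \<in> M"
  shows "finite {h \<in> maximal_avoiding U. q \<in> h}" "card {h \<in> maximal_avoiding U. q \<in> h} \<le> N"
proof -
  let ?K = "{h \<in> maximal_avoiding U. q \<in> h}"
  have tr: "transverse h k" if hk: "h \<in> ?K" "k \<in> ?K" "h \<noteq> k" for h k
  proof -
    have "\<not> h \<subseteq> k" "\<not> k \<subseteq> h" "halfspace h" "halfspace k" "u \<notin> h" "u \<notin> k" "q \<in> h" "q \<in> k"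
      using hk u unfolding maximal_avoiding_def by blast+
    then show ?thesis using u halfspace_subset unfolding transverse_def by blast
  qed
  have bound: "card F \<le> N" if "F \<subseteq> ?K" "finite F" for F
  proof -
    have "pairwise transverse F" using tr that unfolding pairwise_def by blast
    moreover have "\<forall>h\<in>F. halfspace h" using that unfolding maximal_avoiding_def by blast
    ultimately have "enat (card F) \<le> rank"
      unfolding rank_def using that by (intro SUP_upper) auto
    then show ?thesis using N order_trans by fastforce
  qed
  show "finite ?K"
  proof (rule ccontr)
    assume "infinite ?K"
    then obtain F where "finite F" "card F = Suc N" "F \<subseteq> ?K"
      using infinite_arbitrarily_large[of ?K "Suc N"] by auto
    then show False using bound[of F] by simp
  qed
  then show "card ?K \<le> N" using bound by blast
qed

section \<open>Halfspaces between disjoint balls\<close>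

text \<open>Seen from \<open>x\<close>, the interval towards \<open>y\<close> is a join semilattice in which the join of \<open>a'\<close> and \<open>b\<close> is
\<open>med a' b y\<close>. Complements of the given halfspaces contain \<open>y\<close> and are therefore closed upwards, so the
join of one nearby point from each complement lies in all of them. The factor \<open>2\<close> is what the
triangle inequality costs at each step.\<close>

lemma point_outside_finitely_many:
  assumes "finite K" and x: "x \<in> M" and y: "y \<in> M"
    and "\<And>k. k \<in> K \<Longrightarrow> halfspace k \<and> y \<notin> k \<and> (\<exists>a\<in>M - k. d x a \<le> s)"
  shows "\<exists>b\<in>interval x y. d x b \<le> 2 * real (card K) * s \<and> (\<forall>k\<in>K. b \<notin> k)"
  using assms(1,4)
proof (induction K rule: finite_induct)
  case empty
  then show ?case using x y by (intro bexI[of _ x]) (auto simp: interval_ends)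
next
  case (insert k K)
  obtain b where b: "b \<in> interval x y" "d x b \<le> 2 * real (card K) * s" "\<And>k. k \<in> K \<Longrightarrow> b \<notin> k"
    using insert by blast
  obtain a where a: "a \<in> M" "a \<notin> k" "d x a \<le> s" and k: "halfspace k" "y \<notin> k"
    using insert.prems[of k] by auto
  define a' where "a' = med x y a"
  have a': "a' \<in> interval x y" "a' \<in> interval x a" "a' \<in> interval y a" "a' \<in> M"
    using med_in_interval[of x y a] x y a by (auto simp: a'_def med_closed)
  have a'k: "a' \<notin> k" using halfspace_between_compl k a y a' by blast
  have a's: "d x a' \<le> s" using interval_le[OF a'(2)] a(3) by linarith
  have bM: "b \<in> M" using b interval_subset by blast
  define e where "e = med a' b y"
  have e: "e \<in> interval a' b" "e \<in> interval a' y" "e \<in> interval b y" "e \<in> M"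
    using med_in_interval[of a' b y] a' bM y by (auto simp: e_def med_closed)
  have "e \<in> interval x y" using interval_convex[OF x y] a' b e unfolding mconvex_def by blast
  moreover have "d x e \<le> 2 * real (card (insert k K)) * s"
  proof -
    have "d x e \<le> d x a' + d a' e" "d a' b \<le> d a' x + d x b" using triangle x a' e bM by auto
    moreover have "d a' e \<le> d a' b" using interval_le[OF e(1)] .
    ultimately have "d x e \<le> 2 * s + 2 * real (card K) * s"
      using a's b(2) commute[of a' x] by linarith
    then show ?thesis using insert by (simp add: algebra_simps)
  qed
  moreover have "e \<notin> l" if "l \<in> insert k K" for l
  proof (cases "l = k")
    case True
    then show ?thesis using halfspace_between_compl k a'k a' y e by blast
  next
    case False
    then have "l \<in> K" "halfspace l" "y \<notin> l" using that insert.prems by auto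
    then show ?thesis using halfspace_between_compl b bM y e by blast
  qed
  ultimately show ?case by blast
qed

text \<open>It is enough to leave the maximal halfspaces that contain \<open>x\<close> and avoid \<open>U\<close>, and finite rank bounds
their number.\<close>

lemma point_outside_all:
  assumes N: "rank \<le> enat N" and x: "x \<in> M" and y: "y \<in> M" "y \<in> U" and s: "s \<ge> 0"
    and near: "\<And>k. \<lbrakk>halfspace k; x \<in> k; k \<inter> U = {}\<rbrakk> \<Longrightarrow> \<exists>a\<in>M - k. d x a \<le> s"
  shows "\<exists>b\<in>interval x y. d x b \<le> 2 * real N * s \<and>
    (\<forall>k. halfspace k \<longrightarrow> x \<in> k \<longrightarrow> k \<inter> U = {} \<longrightarrow> b \<notin> k)"
proof -
  define K where "K = {k \<in> maximal_avoiding U. x \<in> k}"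
  have fin: "finite K" "card K \<le> N"
    using finite_maximal_avoiding[OF N y(2,1), of x] by (simp_all add: K_def)
  have "\<exists>b\<in>interval x y. d x b \<le> 2 * real (card K) * s \<and> (\<forall>k\<in>K. b \<notin> k)"
  proof (rule point_outside_finitely_many[OF fin(1) x y(1)])
    fix k assume "k \<in> K"
    then have k: "halfspace k" "x \<in> k" "k \<inter> U = {}" unfolding K_def maximal_avoiding_def by auto
    then show "halfspace k \<and> y \<notin> k \<and> (\<exists>a\<in>M - k. d x a \<le> s)"
      using near y by blast
  qed
  then obtain b where b: "b \<in> interval x y" "d x b \<le> 2 * real (card K) * s" "\<forall>k\<in>K. b \<notin> k"
    by blast
  have "2 * real (card K) * s \<le> 2 * real N * s" using fin(2) s by (intro mult_right_mono) auto
  moreover have "b \<notin> k" if k: "halfspace k" "x \<in> k" "k \<inter> U = {}" for k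
  proof -
    obtain k' where "k' \<in> maximal_avoiding U" "k \<subseteq> k'" by (rule maximal_avoiding_exists[OF k(1,3)])
    then show ?thesis using k(2) b(3) unfolding K_def by blast
  qed
  ultimately show ?thesis using b(1,2) by (intro bexI[of _ b]) auto
qed

text \<open>In finite rank a point that is far from \<open>x\<close> lies outside some halfspace containing a ball around \<open>x\<close>.
Otherwise \<open>point_outside_all\<close> yields a point \<open>b\<close> near \<open>x\<close> outside every halfspace that contains \<open>x\<close>
but not \<open>y\<close>. A halfspace containing \<open>b\<close> but not \<open>y\<close> would be one of these, so \<open>b = y\<close>, although \<open>y\<close> is
far from \<open>x\<close>.\<close>

lemma halfspace_containing_ball:
  assumes N: "rank \<le> enat N" and x: "x \<in> M" and y: "y \<in> M" and s: "s \<ge> 0"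
    and far: "2 * real N * s < d x y"
  shows "\<exists>k. halfspace k \<and> y \<notin> k \<and> (\<forall>a\<in>M - k. s < d x a)"
proof (rule ccontr)
  assume neg: "\<not> ?thesis"
  have near: "\<exists>a\<in>M - k. d x a \<le> s" if "halfspace k" "x \<in> k" "k \<inter> {y} = {}" for k
  proof -
    have "\<not> (\<forall>a\<in>M - k. s < d x a)" using neg that by blast
    then show ?thesis by (auto simp: not_less)
  qed
  obtain b where b: "b \<in> interval x y" "d x b \<le> 2 * real N * s"
    and out: "\<forall>k. halfspace k \<longrightarrow> x \<in> k \<longrightarrow> k \<inter> {y} = {} \<longrightarrow> b \<notin> k"
    using point_outside_all[OF N x y singletonI s near] by blast
  have bM: "b \<noteq> y" "b \<in> M" using b far interval_subset by auto
  obtain k where k: "halfspace k" "b \<in> k" "y \<notin> k"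
    by (rule separating_halfspace[OF y bM(2) bM(1)[symmetric]])
  have "x \<in> k" using halfspace_between_compl[OF k(1) x y _ k(3) b(1)] k(2) by blast
  then show False using out k by simp
qed

text \<open>This repeats the previous argument with the ball around \<open>y\<close> in place of \<open>y\<close>. The point \<open>b\<close> is
now within \<open>2 * N * s\<close> of \<open>x\<close>, so it is still far from \<open>y\<close>, and the previous lemma applied around \<open>y\<close> gives
a halfspace that contradicts the choice of \<open>b\<close>.\<close>

lemma halfspace_between_balls:
  assumes N: "rank \<le> enat N" and x: "x \<in> M" and y: "y \<in> M" and s: "s \<ge> 0"
    and far: "4 * real N * s < d x y"
  shows "\<exists>k. halfspace k \<and> (\<forall>a\<in>M - k. s < d x a) \<and> (\<forall>a\<in>k. s < d y a)"
proof (rule ccontr)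
  assume neg: "\<not> ?thesis"
  define U where "U = {a \<in> M. d y a \<le> s}"
  have near: "\<exists>a\<in>M - k. d x a \<le> s" if k: "halfspace k" "x \<in> k" "k \<inter> U = {}" for k
  proof -
    have "\<forall>a\<in>k. s < d y a" using k halfspace_subset unfolding U_def by fastforce
    then have "\<not> (\<forall>a\<in>M - k. s < d x a)" using neg k(1) by blast
    then show ?thesis by (auto simp: not_less)
  qed
  have yU: "y \<in> U" using y s by (simp add: U_def)
  obtain b where b: "b \<in> interval x y" "d x b \<le> 2 * real N * s"
    and out: "\<forall>k. halfspace k \<longrightarrow> x \<in> k \<longrightarrow> k \<inter> U = {} \<longrightarrow> b \<notin> k"
    using point_outside_all[OF N x y yU s near] by blast
  have bM: "b \<in> M" using b(1) interval_subset by blast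
  have "d x y = d x b + d y b" using b(1) by (simp add: interval_def commute)
  then have "2 * real N * s < d y b" using b(2) far by linarith
  then obtain k where k: "halfspace k" "b \<notin> k" "\<forall>a\<in>M - k. s < d y a"
    using halfspace_containing_ball[OF N y bM s] by blast
  have "\<not> s < d y y" using y s by simp
  then have "y \<in> k" using k(3) y by blast
  then have "x \<in> M - k" using halfspace_between[OF k(1) _ _ b(1)] k(2) x by blast
  moreover have "(M - k) \<inter> U = {}"
  proof -
    have "\<not> d y a \<le> s" if "a \<in> M - k" for a using k(3) that by (simp add: not_le)
    then show ?thesis by (auto simp: U_def)
  qed
  ultimately have "b \<notin> M - k" using out halfspace_compl[OF k(1)] by blast
  then show False using k(2) bM by blast
qed

section \<open>The halfspaces cut out by the balls around a point\<close>

text \<open>Nonempty interior is what makes the family countable: a wall then contains a point of a fixed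
countable dense set. Rational radii suffice because the separation argument has room to spare.\<close>

definition distance_walls :: "'a \<Rightarrow> 'a set set" where
  "distance_walls p = {h. \<exists>r\<in>\<rat>. r > 0 \<and> h \<in> maximal_avoiding (mball p r)
     \<and> (\<exists>e\<in>M. \<exists>s>0. mball e s \<subseteq> h)}"

lemma countable_dense_points:
  assumes "separable_space mtopology"
  shows "\<exists>E. countable E \<and> E \<subseteq> M \<and> (\<forall>a\<in>M. \<forall>r>0. \<exists>e\<in>E. d a e < r)"
proof -
  obtain E where E: "countable E" "E \<subseteq> M" "mtopology closure_of E = M"
    using assms unfolding separable_space_def by auto
  have "\<exists>e\<in>E. d a e < r" if "a \<in> M" "r > 0" for a r
  proof -
    have "a \<in> mtopology closure_of E" using E that by simp
    then show ?thesis using that(2) unfolding metric_closure_of by auto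
  qed
  then show ?thesis using E by blast
qed

lemma countable_distance_walls:
  assumes N: "rank \<le> enat N" and sep: "separable_space mtopology" and p: "p \<in> M"
  shows "countable (distance_walls p)"
proof -
  obtain E where E: "countable E" "E \<subseteq> M" "\<forall>a\<in>M. \<forall>r>0. \<exists>e\<in>E. d a e < r"
    using countable_dense_points[OF sep] by blast
  let ?H = "\<lambda>r e. {h \<in> maximal_avoiding (mball p r). e \<in> h}"
  have "distance_walls p \<subseteq> (\<Union>r\<in>{r\<in>\<rat>. r > 0}. \<Union>e\<in>E. ?H r e)"
  proof
    fix h assume "h \<in> distance_walls p"
    then obtain r a s where h: "r \<in> \<rat>" "r > 0" "h \<in> maximal_avoiding (mball p r)" "a \<in> M" "s > 0" "mball a s \<subseteq> h"
      unfolding distance_walls_def by blast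
    then obtain e where "e \<in> E" "d a e < s" using E by blast
    then have "e \<in> h" using h E by (auto simp: subset_iff)
    then show "h \<in> (\<Union>r\<in>{r\<in>\<rat>. r > 0}. \<Union>e\<in>E. ?H r e)" using h \<open>e \<in> E\<close> by blast
  qed
  moreover have "countable (\<Union>r\<in>{r\<in>\<rat>. r > 0}. \<Union>e\<in>E. ?H r e)"
  proof (intro countable_UN E(1))
    show "countable {r\<in>\<rat>. (r::real) > 0}"
      by (rule countable_subset[OF _ countable_rat]) auto
    show "countable (?H r e)" if "r \<in> {r\<in>\<rat>. r > 0}" for r e
      using finite_maximal_avoiding(1)[OF N, of p "mball p r" e] p that
      by (simp add: countable_finite)
  qed
  ultimately show ?thesis by (rule countable_subset)
qed

text \<open>The condition on the median says that \<open>y\<close> is not passed on the way from \<open>p\<close> to \<open>x\<close>, so the wall can be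
asked to have \<open>y\<close> on its far side and \<open>x\<close> on the side of \<open>p\<close>.\<close>

lemma distance_walls_separate_aux:
  assumes N: "rank \<le> enat N" and p: "p \<in> M" and x: "x \<in> M" and y: "y \<in> M"
    and ne: "med p x y \<noteq> y"
  shows "\<exists>h\<in>distance_walls p. y \<in> h \<and> x \<notin> h"
proof -
  define m where "m = med p x y"
  have m: "m \<in> interval p x" "m \<in> interval p y" "m \<in> interval x y" "m \<in> M"
    using med_in_interval[of p x y] p x y by (auto simp: m_def med_closed)
  have pos: "d m y > 0" using ne y m by (simp add: m_def)
  \<comment> \<open>the summand \<open>1\<close> makes the next inequality strict, as \<open>halfspace_between_balls\<close> requires\<close>
  define s where "s = d m y / (4 * real N + 1)"
  have s: "s > 0" "4 * real N * s < d m y"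
    using pos by (auto simp: s_def field_simps)
  obtain k where k: "halfspace k" "\<forall>a\<in>M - k. s < d m a" "\<forall>a\<in>k. s < d y a"
    using halfspace_between_balls[OF N m(4) y less_imp_le[OF s(1)] s(2)] by blast
  define h0 where "h0 = M - k"
  have h0: "halfspace h0" "h0 \<subseteq> M" using halfspace_compl k by (auto simp: h0_def)
  have hm: "s < d m a" if "a \<in> h0" for a using k(2) that by (simp add: h0_def)
  have ball: "mball y s \<subseteq> h0" using k(3) by (force simp: h0_def)
  then have yh0: "y \<in> h0" using y s by auto
  \<comment> \<open>applied to \<open>z = p\<close> to keep the radius positive, and at the end to the projection \<open>e\<close> of \<open>q\<close>\<close>
  have step: "s < d z a" if z: "z \<in> M" "m \<in> interval z y" and a: "a \<in> h0" for z a
  proof -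
    have aM: "a \<in> M" using a h0 by blast
    have "med m y a \<in> h0" using halfspace_between[OF h0(1) yh0 a] med_in_interval(3)[OF m(4) y aM] by blast
    moreover have "med m y z = m" using z m y
      by (intro med_eqI) (auto simp: interval_ends interval_commute)
    ultimately show ?thesis
      using hm[of "med m y a"] med_lipschitz[of m y z a] m y z aM by fastforce
  qed
  let ?\<rho> = "Inf (d p ` h0)"
  have bdd: "bdd_below (d p ` h0)" by (intro bdd_belowI[of _ 0]) auto
  have "s \<le> ?\<rho>"
    using yh0 step[OF p m(2)] by (intro cInf_greatest) (auto intro: less_imp_le)
  then have "max 0 (?\<rho> - s / 4) < ?\<rho>" using s by auto
  then obtain r where r: "r \<in> \<rat>" "max 0 (?\<rho> - s / 4) < r" "r < ?\<rho>"
    using Rats_dense_in_real by blast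
  obtain q where q: "q \<in> h0" "d p q < ?\<rho> + s / 4"
    using cInf_lessD[of "d p ` h0" "?\<rho> + s / 4"] yh0 s by auto
  have "h0 \<inter> mball p r = {}"
  proof -
    have "r < d p z" if "z \<in> h0" for z
      using cInf_lower[OF _ bdd, of "d p z"] that r by auto
    then show ?thesis by force
  qed
  then obtain h where h: "h \<in> maximal_avoiding (mball p r)" "h0 \<subseteq> h"
    using maximal_avoiding_exists h0 by blast
  have hh: "halfspace h" "h \<inter> mball p r = {}" using h unfolding maximal_avoiding_def by auto
  have "x \<notin> h"
  proof
    assume "x \<in> h"
    then have mh: "m \<in> h" using halfspace_between hh m h yh0 by blast
    have qM: "q \<in> M" "q \<in> h" using q h0 h by auto
    define e where "e = med p q m"
    have e: "e \<in> interval p q" "e \<in> interval p m" "e \<in> interval q m" "e \<in> M"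
      using med_in_interval[of p q m] p qM m by (auto simp: e_def med_closed)
    have "e \<in> h" using halfspace_between hh mh qM e by blast
    then have "r \<le> d p e" using hh e p by fastforce
    then have "d e q < s" using e(1) q r by (simp add: interval_def)
    moreover have "m \<in> interval e y" using between_trans(2)[of p y m e] p y m e by blast
    ultimately show False using step[of e q] e q by fastforce
  qed
  moreover have "h \<in> distance_walls p"
  proof -
    have "mball y s \<subseteq> h" using ball h(2) by blast
    then have "\<exists>e\<in>M. \<exists>s>0. mball e s \<subseteq> h" using y s(1) by blast
    then show ?thesis unfolding distance_walls_def using r h(1) by auto
  qed
  ultimately show ?thesis using yh0 h(2) by blast
qed

lemma distance_walls_separate:
  assumes N: "rank \<le> enat N" and p: "p \<in> M" and x: "x \<in> M" and y: "y \<in> M" and "x \<noteq> y"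
  shows "\<exists>h\<in>distance_walls p. separates h x y"
proof (cases "med p x y = y")
  case False
  then show ?thesis
    using distance_walls_separate_aux[OF N p x y] unfolding separates_def by blast
next
  case True
  then have "med p y x \<noteq> x" using \<open>x \<noteq> y\<close> med_perm(2)[OF p x y] by simp
  then show ?thesis
    using distance_walls_separate_aux[OF N p y x] unfolding separates_def by blast
qed

section \<open>Equivariance\<close>

lemma isom_bij: "g \<in> isom \<Longrightarrow> bij_betw g M M"
  by (simp add: isom_def)

lemma isom_closed: "\<lbrakk>g \<in> isom; x \<in> M\<rbrakk> \<Longrightarrow> g x \<in> M"
  using isom_bij bij_betw_apply by metis

lemma isom_dist: "\<lbrakk>g \<in> isom; x \<in> M; y \<in> M\<rbrakk> \<Longrightarrow> d (g x) (g y) = d x y"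
  by (simp add: isom_def)

lemma isom_inverse:
  assumes g: "g \<in> isom"
  obtains g' where "g' \<in> isom" "\<And>x. x \<in> M \<Longrightarrow> g (g' x) = x" "\<And>x. x \<in> M \<Longrightarrow> g' (g x) = x"
proof
  let ?g' = "restrict (inv_into M g) M"
  note bij = isom_bij[OF g]
  show gg': "g (?g' x) = x" if "x \<in> M" for x
    using that bij_betw_inv_into_right[OF bij] by simp
  show "?g' (g x) = x" if "x \<in> M" for x
    using that bij_betw_inv_into_left[OF bij] isom_closed[OF g] by simp
  have b: "bij_betw ?g' M M" using bij_betw_inv_into[OF bij] by (simp cong: bij_betw_cong)
  moreover have "d (?g' x) (?g' y) = d x y" if xy: "x \<in> M" "y \<in> M" for x y
  proof -
    have "?g' x \<in> M" "?g' y \<in> M" using b xy by (auto dest: bij_betwE)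
    then show ?thesis using isom_dist[OF g, of "?g' x" "?g' y"] gg'[OF xy(1)] gg'[OF xy(2)] by simp
  qed
  ultimately show "?g' \<in> isom" by (simp add: isom_def)
qed

lemma isom_image_Diff: "\<lbrakk>g \<in> isom; A \<subseteq> M\<rbrakk> \<Longrightarrow> M - g ` A = g ` (M - A)"
  using isom_bij[of g] inj_on_image_set_diff[of g M M A] by (simp add: bij_betw_def)

lemma isom_image_cancel:
  "\<lbrakk>\<And>x. x \<in> M \<Longrightarrow> g (g' x) = x; A \<subseteq> M\<rbrakk> \<Longrightarrow> g ` g' ` A = A"
  unfolding image_image by (subst image_cong[where g = "\<lambda>x. x"]) auto

lemma isom_image_mball:
  assumes g: "g \<in> isom" and a: "a \<in> M"
  shows "g ` mball a r = mball (g a) r"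
proof -
  obtain g' where g': "g' \<in> isom" "\<And>x. x \<in> M \<Longrightarrow> g (g' x) = x"
    using isom_inverse[OF g] by metis
  show ?thesis
  proof (intro equalityI subsetI)
    fix x assume "x \<in> g ` mball a r"
    then show "x \<in> mball (g a) r" using g a by (auto simp: isom_closed isom_dist)
  next
    fix x assume x: "x \<in> mball (g a) r"
    then have "g' x \<in> mball a r"
      using isom_dist[OF g a, of "g' x"] g' a isom_closed by auto
    then show "x \<in> g ` mball a r" using g' x by force
  qed
qed

lemma isom_image_mconvex:
  assumes g: "g \<in> isom" and A: "mconvex A"
  shows "mconvex (g ` A)"
proof -
  obtain g' where g': "g' \<in> isom" "\<And>x. x \<in> M \<Longrightarrow> g (g' x) = x" "\<And>x. x \<in> M \<Longrightarrow> g' (g x) = x"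
    using isom_inverse[OF g] by metis
  have AM: "A \<subseteq> M" using A by (simp add: mconvex_def)
  show ?thesis
    unfolding mconvex_def
  proof (intro conjI ballI subsetI)
    show "x \<in> M" if "x \<in> g ` A" for x using that AM isom_closed[OF g] by auto
    fix x y c assume "x \<in> g ` A" "y \<in> g ` A" and c: "c \<in> interval x y"
    then obtain a b where ab: "a \<in> A" "x = g a" "b \<in> A" "y = g b" by auto
    have "g' c \<in> interval (g' x) (g' y)"
      using isom_interval[OF g'(1) _ _ c] ab AM isom_closed[OF g] by blast
    moreover have "g' x = a" "g' y = b" using ab AM g'(3) by auto
    ultimately have "g' c \<in> A" using A ab unfolding mconvex_def by auto
    moreover have "g (g' c) = c" using g'(2) interval_subset[OF c] by simp
    ultimately show "c \<in> g ` A" by force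
  qed
qed

lemma isom_image_halfspace: "\<lbrakk>g \<in> isom; halfspace h\<rbrakk> \<Longrightarrow> halfspace (g ` h)"
  using isom_image_mconvex[of g h] isom_image_mconvex[of g "M - h"] isom_image_Diff[of g h]
  by (simp add: halfspace_def mconvex_def)

lemma isom_image_maximal_avoiding:
  assumes g: "g \<in> isom" and h: "h \<in> maximal_avoiding U" and U: "U \<subseteq> M"
  shows "g ` h \<in> maximal_avoiding (g ` U)"
proof -
  obtain g' where g': "g' \<in> isom" "\<And>x. x \<in> M \<Longrightarrow> g (g' x) = x" "\<And>x. x \<in> M \<Longrightarrow> g' (g x) = x"
    using isom_inverse[OF g] by metis
  note hU = maximal_avoidingD[OF h]
  have hM: "h \<subseteq> M" by (rule halfspace_subset[OF hU(1)])
  show ?thesis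
  proof (rule maximal_avoidingI)
    show "halfspace (g ` h)" by (rule isom_image_halfspace[OF g hU(1)])
    show "g ` h \<inter> g ` U = {}"
      using hU(2) inj_on_image_Int[of g M h U] hM U isom_bij[OF g] by (simp add: bij_betw_def)
    fix k assume k: "halfspace k" "k \<inter> g ` U = {}" "g ` h \<subseteq> k"
    have kM: "k \<subseteq> M" by (rule halfspace_subset[OF k(1)])
    have kk: "g ` g' ` k = k" using isom_image_cancel[of g g' k] g'(2) kM by simp
    have "g' ` k = h"
    proof (rule hU(3))
      show "halfspace (g' ` k)" by (rule isom_image_halfspace[OF g'(1) k(1)])
      show "g' ` k \<inter> U = {}"
      proof (rule ccontr)
        assume "g' ` k \<inter> U \<noteq> {}"
        then obtain x where x: "x \<in> k" "g' x \<in> U" by auto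
        have "g (g' x) = x" using g'(2) x(1) kM by (simp add: subset_iff)
        then have "x \<in> g ` U" using x(2) image_eqI[of x g "g' x" U] by simp
        then show False using k(2) x(1) by (simp add: disjoint_iff)
      qed
      show "h \<subseteq> g' ` k"
      proof
        fix x assume x: "x \<in> h"
        then have "g' (g x) = x" "g x \<in> k" using g'(3) hM k(3) by (auto simp: subset_iff)
        then show "x \<in> g' ` k" using image_eqI[of x g' "g x" k] by simp
      qed
    qed
    then show "k = g ` h" using kk by simp
  qed
qed

lemma isom_image_distance_walls:
  assumes g: "g \<in> isom" and p: "p \<in> M" and h: "h \<in> distance_walls p"
  shows "g ` h \<in> distance_walls (g p)"
proof -
  obtain r e s where h: "r \<in> \<rat>" "r > 0" "h \<in> maximal_avoiding (mball p r)" "e \<in> M" "s > 0" "mball e s \<subseteq> h"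
    using h unfolding distance_walls_def by blast
  have "mball (g e) s \<subseteq> g ` h"
    using isom_image_mball[OF g h(4), of s] h(6) by blast
  moreover have "g ` h \<in> maximal_avoiding (mball (g p) r)"
    using isom_image_maximal_avoiding[OF g h(3) mball_subset_mspace] isom_image_mball[OF g p, of r]
    by simp
  ultimately show ?thesis
    unfolding distance_walls_def using h(1,2,5) isom_closed[OF g h(4)] by blast
qed

section \<open>A canonical countable set of points\<close>

text \<open>Values of the median that do not change when the three points are moved a little. In a real tree
with more than one point these are the branch points.\<close>

definition stable_medians :: "'a set" where
  "stable_medians = {p. \<exists>a1\<in>M. \<exists>a2\<in>M. \<exists>a3\<in>M. \<exists>r>0.
     \<forall>y1\<in>mball a1 r. \<forall>y2\<in>mball a2 r. \<forall>y3\<in>mball a3 r. med y1 y2 y3 = p}"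

text \<open>A gap in the space, with \<open>k\<close> on one side, that can be crossed only from \<open>p\<close> to \<open>q\<close>.\<close>

definition bridge :: "'a set \<Rightarrow> 'a \<Rightarrow> 'a \<Rightarrow> bool" where
  "bridge k p q \<longleftrightarrow> k \<subseteq> M \<and> p \<in> k \<and> q \<in> M - k \<and>
     (\<forall>z\<in>k. \<forall>z'\<in>M - k. d z z' = d z p + d p q + d q z')"

definition anchors :: "'a set" where
  "anchors = stable_medians \<union> {p. \<exists>k q. bridge k p q}"

lemma bridge_points:
  assumes "bridge k p q"
  shows "p \<in> k" "q \<notin> k" "p \<in> M" "q \<in> M" "k \<subseteq> M"
proof -
  note D = iffD1[OF bridge_def assms]
  have "k \<subseteq> M" "p \<in> k" "q \<in> M - k"
    by (rule conjunct1[OF D] conjunct1[OF conjunct2[OF D]]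
        conjunct1[OF conjunct2[OF conjunct2[OF D]]])+
  then show "p \<in> k" "q \<notin> k" "p \<in> M" "q \<in> M" "k \<subseteq> M" by auto
qed

lemma bridge_dist:
  assumes "bridge k p q" "z \<in> k" "z' \<in> M" "z' \<notin> k"
  shows "d z z' = d z p + d p q + d q z'"
proof -
  have "\<forall>z\<in>k. \<forall>z'\<in>M - k. d z z' = d z p + d p q + d q z'"
    using iffD1[OF bridge_def assms(1)] by (elim conjE)
  then show ?thesis using assms(2-4) by blast
qed

lemma stable_medians_subset: "stable_medians \<subseteq> M"
proof
  fix p assume "p \<in> stable_medians"
  then obtain a1 a2 a3 r where a: "a1 \<in> M" "a2 \<in> M" "a3 \<in> M" "r > 0"
    "\<forall>y1\<in>mball a1 r. \<forall>y2\<in>mball a2 r. \<forall>y3\<in>mball a3 r. med y1 y2 y3 = p"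
    unfolding stable_medians_def by blast
  then have "med a1 a2 a3 = p" by simp
  then show "p \<in> M" using med_closed[OF a(1-3)] by simp
qed

lemma anchors_subset: "anchors \<subseteq> M"
proof -
  have "{p. \<exists>k q. bridge k p q} \<subseteq> M" using bridge_points(3) by auto
  then show ?thesis using stable_medians_subset by (simp add: anchors_def)
qed

lemma countable_stable_medians:
  assumes sep: "separable_space mtopology"
  shows "countable stable_medians"
proof -
  obtain E where E: "countable E" "E \<subseteq> M" "\<forall>a\<in>M. \<forall>r>0. \<exists>e\<in>E. d a e < r"
    using countable_dense_points[OF sep] by blast
  have dense: "\<exists>e\<in>E. e \<in> mball a r" if "a \<in> M" "r > 0" for a r
    using E(2,3) that by fastforce
  have "stable_medians \<subseteq> (\<lambda>(x, y, z). med x y z) ` (E \<times> E \<times> E)"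
  proof
    fix p assume "p \<in> stable_medians"
    then obtain a1 a2 a3 r where a: "a1 \<in> M" "a2 \<in> M" "a3 \<in> M" "r > 0"
      "\<forall>y1\<in>mball a1 r. \<forall>y2\<in>mball a2 r. \<forall>y3\<in>mball a3 r. med y1 y2 y3 = p"
      unfolding stable_medians_def by blast
    obtain e1 where e1: "e1 \<in> E" "e1 \<in> mball a1 r" using dense[OF a(1,4)] by blast
    obtain e2 where e2: "e2 \<in> E" "e2 \<in> mball a2 r" using dense[OF a(2,4)] by blast
    obtain e3 where e3: "e3 \<in> E" "e3 \<in> mball a3 r" using dense[OF a(3,4)] by blast
    have "p = med e1 e2 e3" using a(5) e1 e2 e3 by simp
    then show "p \<in> (\<lambda>(x, y, z). med x y z) ` (E \<times> E \<times> E)" using e1 e2 e3 by force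
  qed
  moreover have "countable ((\<lambda>(x, y, z). med x y z) ` (E \<times> E \<times> E))"
    using E(1) by (intro countable_image countable_SIGMA)
  ultimately show ?thesis by (rule countable_subset)
qed

text \<open>The length of the bridge exceeds the distances from \<open>p\<close> to \<open>p'\<close> and from \<open>q\<close> to \<open>q'\<close>, so \<open>p'\<close> and \<open>q'\<close> are
still on the sides of \<open>p\<close> and \<open>q\<close>.\<close>

lemma bridge_dist_near:
  assumes b: "bridge k p q" and M: "p' \<in> M" "q' \<in> M" and "d p p' < d p q" "d q q' < d p q"
  shows "d p' q' = d p' p + d p q + d q q'"
proof -
  have "p' \<in> k"
  proof (rule ccontr)
    assume "p' \<notin> k"
    then have "d p p' = d p p + d p q + d q p'" by (intro bridge_dist[OF b] bridge_points[OF b] M)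
    then show False using assms(4) nonneg[of p p] nonneg[of q p'] by linarith
  qed
  moreover have "q' \<notin> k"
  proof
    assume "q' \<in> k"
    then have "d q' q = d q' p + d p q + d q q" by (intro bridge_dist[OF b] bridge_points[OF b])
    then show False using assms(5) nonneg[of q' p] nonneg[of q q] commute[of q q'] by linarith
  qed
  ultimately show ?thesis by (intro bridge_dist[OF b] M)
qed

text \<open>Two bridges that are close in comparison with their lengths would each have to be crossed on the
way between the ends of the other, so each would be at least as long as the other plus the
distances between their ends.\<close>

lemma bridge_unique:
  assumes b: "bridge k p q" and b': "bridge k' p' q'"
    and "d p p' < d p q" "d q q' < d p q" "d p p' < d p' q'" "d q q' < d p' q'"
  shows "p = p'"
proof -
  note M = bridge_points(3,4)[OF b] bridge_points(3,4)[OF b']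
  have "d p' q' = d p' p + d p q + d q q'"
    by (rule bridge_dist_near[OF b M(3,4) assms(3,4)])
  moreover have "d p' p < d p' q'" "d q' q < d p' q'"
    using assms(5,6) commute[of p p'] commute[of q q'] by linarith+
  then have "d p q = d p p' + d p' q' + d q' q"
    by (rule bridge_dist_near[OF b' M(1,2)])
  ultimately have "d p p' = 0"
    using nonneg[of p p'] nonneg[of p' p] nonneg[of q q'] nonneg[of q' q] by linarith
  then show ?thesis using zero[OF M(1,3)] by (rule iffD1[rotated])
qed

lemma countable_bridge:
  assumes sep: "separable_space mtopology"
  shows "countable {p. \<exists>k q. bridge k p q}"
proof -
  obtain E where E: "countable E" "E \<subseteq> M" "\<forall>a\<in>M. \<forall>r>0. \<exists>e\<in>E. d a e < r"
    using countable_dense_points[OF sep] by blast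
  \<comment> \<open>the end \<open>p\<close> is determined by a lower bound on the length and by points of \<open>E\<close> near both ends\<close>
  define S where "S = (\<lambda>n e f. {p. \<exists>k q. bridge k p q \<and> 2 * inverse (real (Suc n)) < d p q
      \<and> d p e < inverse (real (Suc n)) \<and> d q f < inverse (real (Suc n))})"
  have S1: "p = p'" if p: "p \<in> S n e f" "p' \<in> S n e f" and ef: "e \<in> E" "f \<in> E" for n e f p p'
  proof -
    let ?t = "inverse (real (Suc n))"
    obtain k q where q: "bridge k p q" "2 * ?t < d p q" "d p e < ?t" "d q f < ?t"
      using p(1) unfolding S_def by blast
    obtain k' q' where q': "bridge k' p' q'" "2 * ?t < d p' q'" "d p' e < ?t" "d q' f < ?t"
      using p(2) unfolding S_def by blast
    have M: "p \<in> M" "q \<in> M" "p' \<in> M" "q' \<in> M" "e \<in> M" "f \<in> M"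
      using bridge_points(3,4)[OF q(1)] bridge_points(3,4)[OF q'(1)] ef E(2) by auto
    have "d p p' \<le> d p e + d e p'" "d q q' \<le> d q f + d f q'"
      using triangle M by auto
    then have "d p p' < 2 * ?t" "d q q' < 2 * ?t"
      using q(3,4) q'(3,4) commute[of e p'] commute[of f q'] by linarith+
    then show ?thesis
      using bridge_unique[OF q(1) q'(1)] q(2) q'(2) by linarith
  qed
  have "finite (S n e f)" if "e \<in> E" "f \<in> E" for n e f
  proof (cases "S n e f = {}")
    case False
    then obtain p where p: "p \<in> S n e f" by auto
    have "S n e f \<subseteq> {p}"
    proof
      fix x assume "x \<in> S n e f"
      then show "x \<in> {p}" using S1[OF _ p that] by simp
    qed
    then show ?thesis by (rule finite_subset) simp
  qed simp
  then have "countable (\<Union>n. \<Union>e\<in>E. \<Union>f\<in>E. S n e f)"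
    using E(1) by (intro countable_UN) (simp_all add: countable_finite)
  moreover have "{p. \<exists>k q. bridge k p q} \<subseteq> (\<Union>n. \<Union>e\<in>E. \<Union>f\<in>E. S n e f)"
  proof
    fix p assume "p \<in> {p. \<exists>k q. bridge k p q}"
    then obtain k q where q: "bridge k p q" by blast
    then have M: "p \<in> M" "q \<in> M" "p \<noteq> q" using bridge_points[OF q] by auto
    then have "0 < d p q / 2" by simp
    then obtain n where n: "inverse (real (Suc n)) < d p q / 2" using reals_Archimedean by blast
    have t: "0 < inverse (real (Suc n))" by simp
    obtain e where e: "e \<in> E" "d p e < inverse (real (Suc n))" using E(3) M(1) t by blast
    obtain f where f: "f \<in> E" "d q f < inverse (real (Suc n))" using E(3) M(2) t by blast
    have "2 * inverse (real (Suc n)) < d p q" using n by simp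
    then have "p \<in> S n e f" unfolding S_def using q e(2) f(2) by blast
    then show "p \<in> (\<Union>n. \<Union>e\<in>E. \<Union>f\<in>E. S n e f)" using e(1) f(1) by blast
  qed
  ultimately show ?thesis by (rule countable_subset[rotated])
qed

lemma countable_anchors: "separable_space mtopology \<Longrightarrow> countable anchors"
  unfolding anchors_def by (intro countable_Un countable_stable_medians countable_bridge)

lemma isom_stable_medians:
  assumes g: "g \<in> isom" and p: "p \<in> stable_medians"
  shows "g p \<in> stable_medians"
proof -
  obtain a1 a2 a3 r where a: "a1 \<in> M" "a2 \<in> M" "a3 \<in> M" "r > 0"
    "\<forall>y1\<in>mball a1 r. \<forall>y2\<in>mball a2 r. \<forall>y3\<in>mball a3 r. med y1 y2 y3 = p"
    using p unfolding stable_medians_def by blast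
  have "med z1 z2 z3 = g p"
    if z: "z1 \<in> mball (g a1) r" "z2 \<in> mball (g a2) r" "z3 \<in> mball (g a3) r" for z1 z2 z3
  proof -
    obtain y1 y2 y3 where y: "y1 \<in> mball a1 r" "y2 \<in> mball a2 r" "y3 \<in> mball a3 r"
      "z1 = g y1" "z2 = g y2" "z3 = g y3"
      using z isom_image_mball[OF g a(1)] isom_image_mball[OF g a(2)] isom_image_mball[OF g a(3)]
      by blast
    then have "med z1 z2 z3 = g (med y1 y2 y3)" using isom_med[OF g, of y1 y2 y3] by simp
    then show ?thesis using a(5) y by simp
  qed
  moreover have "g a1 \<in> M" "g a2 \<in> M" "g a3 \<in> M" using a isom_closed[OF g] by auto
  ultimately show ?thesis unfolding stable_medians_def using a(4) by blast
qed

lemma isom_bridge: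
  assumes g: "g \<in> isom" and b: "bridge k p q"
  shows "bridge (g ` k) (g p) (g q)"
proof -
  note B = bridge_points[OF b]
  note diff = isom_image_Diff[OF g B(5)]
  have dist: "d (g z) (g z') = d (g z) (g p) + d (g p) (g q) + d (g q) (g z')"
    if z: "z \<in> k" "z' \<in> M - k" for z z'
  proof -
    have "z \<in> M" "z' \<in> M" using z B(5) by auto
    then show ?thesis
      using bridge_dist[OF b, of z z'] z isom_dist[OF g] B(3,4) by simp
  qed
  show ?thesis
    unfolding bridge_def diff
  proof (intro conjI ballI)
    show "g ` k \<subseteq> M" using B(5) isom_closed[OF g] by auto
    show "g p \<in> g ` k" using B(1) by (rule imageI)
    show "g q \<in> g ` (M - k)" using B(2,4) by blast
  next
    fix z z' assume "z \<in> g ` k" "z' \<in> g ` (M - k)"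
    then obtain w w' where "w \<in> k" "z = g w" "w' \<in> M - k" "z' = g w'" by auto
    then show "d z z' = d z (g p) + d (g p) (g q) + d (g q) z'" using dist[of w w'] by simp
  qed
qed

lemma isom_anchors:
  assumes g: "g \<in> isom" and p: "p \<in> anchors"
  shows "g p \<in> anchors"
proof (cases "p \<in> stable_medians")
  case True
  then show ?thesis using isom_stable_medians[OF g] by (simp add: anchors_def)
next
  case False
  then obtain k q where "bridge k p q" using p by (auto simp: anchors_def)
  then have "\<exists>k q. bridge k (g p) q" using isom_bridge[OF g] by (intro exI)
  then show ?thesis by (simp add: anchors_def)
qed

lemma isom_image_anchor_walls:
  assumes g: "g \<in> isom"
  shows "(\<lambda>h. g ` h) ` (\<Union>p\<in>anchors. distance_walls p) = (\<Union>p\<in>anchors. distance_walls p)"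
proof -
  define H where "H = (\<Union>p\<in>anchors. distance_walls p)"
  have inv: "f ` h \<in> H" if f: "f \<in> isom" and h: "h \<in> H" for f h
  proof -
    obtain p where p: "p \<in> anchors" "h \<in> distance_walls p" using h unfolding H_def by (rule UN_E)
    have "p \<in> M" using p(1) anchors_subset by (rule rev_subsetD)
    then show ?thesis
      using isom_image_distance_walls[OF f _ p(2)] isom_anchors[OF f p(1)] by (auto simp: H_def)
  qed
  have sub: "h \<subseteq> M" if "h \<in> H" for h
    using that halfspace_subset by (auto simp: H_def distance_walls_def maximal_avoiding_def)
  obtain g' where g': "g' \<in> isom" "\<And>x. x \<in> M \<Longrightarrow> g (g' x) = x"
    using isom_inverse[OF g] by metis
  have "h \<in> (\<lambda>h. g ` h) ` H" if h: "h \<in> H" for h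
  proof (rule image_eqI)
    show "h = g ` (g' ` h)" using isom_image_cancel[of g g' h] g'(2) sub[OF h] by simp
    show "g' ` h \<in> H" by (rule inv[OF g'(1) h])
  qed
  moreover have "(\<lambda>h. g ` h) ` H \<subseteq> H" using inv[OF g] by auto
  ultimately have "(\<lambda>h. g ` h) ` H = H" by auto
  then show ?thesis by (simp only: H_def)
qed

section \<open>Strongly separated halfspaces\<close>

text \<open>A halfspace separating the two medians would separate \<open>z\<close> from \<open>z'\<close> as well as \<open>a\<close> from \<open>b\<close>, by majority
vote, and so it would be transverse to both \<open>M - h\<close> and \<open>k\<close>.\<close>

lemma strongly_separated_med:
  assumes h: "halfspace h" and ss: "strongly_separated (M - h) k"
    and ab: "a \<in> M - h" "b \<in> M - h" and z: "z \<in> k" "z' \<in> k"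
  shows "med z a b = med z' a b"
proof (rule ccontr)
  assume ne: "med z a b \<noteq> med z' a b"
  have k: "halfspace k" "(M - h) \<inter> k = {}" using ss by (simp_all add: strongly_separated_def)
  have kh: "k \<subseteq> h" "k \<subseteq> M" "h \<subseteq> M" using k halfspace_subset[of k] halfspace_subset[OF h] by auto
  have M: "a \<in> M" "b \<in> M" "z \<in> M" "z' \<in> M" using ab z kh by auto
  obtain j where j: "halfspace j" "med z' a b \<in> j" "med z a b \<notin> j"
    by (rule separating_halfspace[OF med_closed[OF M(3,1,2)] med_closed[OF M(4,1,2)] ne])
  have zj: "z' \<in> j" "z \<notin> j" and abj: "a \<in> j \<longleftrightarrow> b \<notin> j"
    using j(2,3) halfspace_med[OF j(1) M(3,1,2)] halfspace_med[OF j(1) M(4,1,2)] by blast+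
  have hz: "z \<in> h" "z' \<in> h" "a \<notin> h" "b \<notin> h" "a \<notin> k" "b \<notin> k" using z ab kh by auto
  obtain c c' where c: "c \<in> {a, b}" "c \<in> j" "c' \<in> {a, b}" "c' \<notin> j"
    using abj by (cases "a \<in> j") auto
  then have "c \<in> M" "c' \<in> M" "c \<notin> h" "c' \<notin> h" "c \<notin> k" "c' \<notin> k" using M hz by auto
  then have quarters: "z' \<in> j \<inter> h" "z \<in> (M - j) \<inter> h" "c \<in> j \<inter> (M - h)" "c' \<in> (M - j) \<inter> (M - h)"
    "z' \<in> j \<inter> k" "z \<in> (M - j) \<inter> k" "c \<in> j \<inter> (M - k)" "c' \<in> (M - j) \<inter> (M - k)"
    using zj c(2,4) hz z M by auto
  have hh: "M - (M - h) = h" using kh by (simp add: double_diff)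
  have "transverse j (M - h)" unfolding transverse_def hh using quarters(1-4) by blast
  moreover have "transverse j k" unfolding transverse_def using quarters(5-8) by blast
  ultimately have "\<exists>j. halfspace j \<and> transverse j (M - h) \<and> transverse j k"
    using j(1) by (intro exI[of _ j] conjI)
  then show False using ss by (simp only: strongly_separated_def simp_thms)
qed

text \<open>The gate is the nearest point. A minimizing sequence is Cauchy because the median of \<open>a\<close> and two of
its members is again in \<open>C\<close>, hence no closer to \<open>a\<close> than the infimum, while it lies between the two
members.\<close>

lemma closed_convex_gate:
  assumes comp: mcomplete and C: "closedin mtopology C" "mconvex C" "C \<noteq> {}" and a: "a \<in> M"
  shows "\<exists>u\<in>C. \<forall>z\<in>C. u \<in> interval a z"
proof -
  have CM: "C \<subseteq> M" using C(2) by (simp add: mconvex_def)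
  define \<rho> where "\<rho> = Inf (d a ` C)"
  have bdd: "bdd_below (d a ` C)" by (intro bdd_belowI[of _ 0]) auto
  have lower: "\<rho> \<le> d a z" if "z \<in> C" for z
    unfolding \<rho>_def using bdd that by (intro cInf_lower) auto
  have "\<exists>z\<in>C. d a z < \<rho> + inverse (real (Suc n))" for n
  proof -
    have "\<rho> < \<rho> + inverse (real (Suc n))" by simp
    then show ?thesis
      using cInf_lessD[of "d a ` C" "\<rho> + inverse (real (Suc n))"] C(3) unfolding \<rho>_def by auto
  qed
  then obtain \<sigma> where \<sigma>: "\<And>n. \<sigma> n \<in> C" "\<And>n. d a (\<sigma> n) < \<rho> + inverse (real (Suc n))"
    by metis
  have close: "d (\<sigma> n) (\<sigma> l) < inverse (real (Suc n)) + inverse (real (Suc l))" for n l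
  proof -
    have M: "\<sigma> n \<in> M" "\<sigma> l \<in> M" using \<sigma>(1) CM by auto
    define m where "m = med (\<sigma> n) (\<sigma> l) a"
    have m: "m \<in> interval (\<sigma> n) (\<sigma> l)" "m \<in> interval (\<sigma> n) a" "m \<in> interval (\<sigma> l) a"
      using med_in_interval[OF M a] by (simp_all add: m_def)
    have "m \<in> C" unfolding m_def by (rule med_convex[OF C(2) \<sigma>(1) \<sigma>(1) a])
    then have "\<rho> \<le> d a m" by (rule lower)
    moreover have "d (\<sigma> n) (\<sigma> l) = d (\<sigma> n) m + d (\<sigma> l) m"
      "d a (\<sigma> n) = d (\<sigma> n) m + d a m" "d a (\<sigma> l) = d (\<sigma> l) m + d a m"
      using m by (simp_all add: interval_def commute)
    ultimately show ?thesis using \<sigma>(2)[of n] \<sigma>(2)[of l] by linarith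
  qed
  have "MCauchy \<sigma>"
    unfolding MCauchy_def
  proof (intro conjI allI impI)
    show "range \<sigma> \<subseteq> M" using \<sigma>(1) CM by auto
    fix \<epsilon> :: real assume "\<epsilon> > 0"
    then have "0 < \<epsilon> / 2" by simp
    then obtain N where N: "inverse (real (Suc N)) < \<epsilon> / 2" using reals_Archimedean by blast
    have "d (\<sigma> n) (\<sigma> l) < \<epsilon>" if "N \<le> n" "N \<le> l" for n l
    proof -
      have "inverse (real (Suc n)) \<le> inverse (real (Suc N))"
        "inverse (real (Suc l)) \<le> inverse (real (Suc N))"
        using that by (auto intro!: le_imp_inverse_le)
      then show ?thesis using close[of n l] N by linarith
    qed
    then show "\<exists>N. \<forall>n n'. N \<le> n \<longrightarrow> N \<le> n' \<longrightarrow> d (\<sigma> n) (\<sigma> n') < \<epsilon>" by blast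
  qed
  then obtain u where u: "limitin mtopology \<sigma> u sequentially" using comp mcomplete_def by blast
  have uC: "u \<in> C" using C(1) u \<sigma>(1) unfolding metric_closedin_iff_sequentially_closed by blast
  then have uM: "u \<in> M" using CM by blast
  have "d a u \<le> \<rho> + \<epsilon>" if "\<epsilon> > 0" for \<epsilon> :: real
  proof -
    have e: "0 < \<epsilon> / 2" using that by simp
    obtain N where N: "\<And>n. n \<ge> N \<Longrightarrow> d (\<sigma> n) u < \<epsilon> / 2"
      using u e unfolding limit_metric_sequentially by blast
    obtain k where k: "inverse (real (Suc k)) < \<epsilon> / 2" using reals_Archimedean[OF e] by blast
    define n where "n = max N k"
    have "inverse (real (Suc n)) \<le> inverse (real (Suc k))"
      by (auto intro!: le_imp_inverse_le simp: n_def)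
    moreover have "d a u \<le> d a (\<sigma> n) + d (\<sigma> n) u" using triangle a uM \<sigma>(1) CM by blast
    moreover have "d (\<sigma> n) u < \<epsilon> / 2" by (rule N) (simp add: n_def)
    ultimately show ?thesis using \<sigma>(2)[of n] k by linarith
  qed
  then have near: "d a u \<le> \<rho>" by (rule field_le_epsilon)
  have "u \<in> interval a z" if z: "z \<in> C" for z
  proof -
    have zM: "z \<in> M" using z CM by blast
    define m where "m = med u z a"
    have m: "m \<in> interval u a" "m \<in> interval z a"
      using med_in_interval[OF uM zM a] by (simp_all add: m_def)
    have "m \<in> C" unfolding m_def by (rule med_convex[OF C(2) uC z a])
    then have "\<rho> \<le> d a m" by (rule lower)
    then have "d u m \<le> 0" using m(1) near by (simp add: interval_def commute)
    then have "u = m" using uM interval_subset[OF m(1)] nonneg[of u m] by simp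
    then show ?thesis using m(2) by (simp add: interval_commute)
  qed
  then show ?thesis using uC by blast
qed

lemma halfspace_gap_closed:
  assumes "halfspace k" and "r > 0" and gap: "\<forall>a\<in>M - k. \<forall>b\<in>k. r < d a b"
  shows "closedin mtopology k"
  unfolding closedin_metric
proof (intro conjI allI impI)
  show "k \<subseteq> M" by (rule halfspace_subset[OF assms(1)])
  fix x assume x: "x \<in> M - k"
  have "disjnt k (mball x r)"
  proof -
    have "r < d x b" if "b \<in> k" for b using gap x that by simp
    then have "\<not> d x b < r" if "b \<in> k" for b using that by (simp add: not_less less_imp_le)
    then show ?thesis by (auto simp: disjnt_def)
  qed
  then show "\<exists>r>0. disjnt k (mball x r)" using assms(2) by blast
qed

text \<open>By strong separation, the gate of one point outside \<open>k\<close> is the gate of all of them.\<close>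

lemma halfspace_gate:
  assumes comp: mcomplete and k: "halfspace k" "k \<noteq> {}" "k \<noteq> M" and "r > 0"
    and gap: "\<forall>a\<in>M - k. \<forall>b\<in>k. r < d a b" and ss: "strongly_separated k (M - k)"
  shows "\<exists>u\<in>k. \<forall>a\<in>M - k. \<forall>z\<in>k. u \<in> interval a z"
proof -
  have kM: "k \<subseteq> M" by (rule halfspace_subset[OF k(1)])
  obtain b where b: "b \<in> M - k" using k(3) kM by blast
  have "mconvex k" using k(1) by (simp add: halfspace_def)
  then have "\<exists>u\<in>k. \<forall>z\<in>k. u \<in> interval b z"
    using closed_convex_gate[OF comp halfspace_gap_closed[OF k(1) \<open>r > 0\<close> gap]] k(2) b by simp
  then obtain u where u: "u \<in> k" "\<forall>z\<in>k. u \<in> interval b z" by (rule bexE)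
  have "u \<in> interval a z" if a: "a \<in> M - k" and z: "z \<in> k" for a z
  proof -
    have M: "a \<in> M" "b \<in> M" "u \<in> M" "z \<in> M" using a b u(1) z kM by auto
    have "u \<in> M - (M - k)" "z \<in> M - (M - k)" "strongly_separated (M - (M - k)) (M - k)"
      using u(1) z kM ss by (auto simp: double_diff)
    then have "med a u z = med b u z"
      by (intro strongly_separated_med[OF halfspace_compl[OF k(1)] _ _ _ a b])
    also have "\<dots> = u" using M u(2) z by (intro med_eqI) (auto simp: interval_ends)
    finally show ?thesis using med_in_interval(2)[OF M(1,3,4)] by simp
  qed
  then show ?thesis using u(1) by blast
qed

lemma bridge_of_isolated_halfspace:
  assumes comp: mcomplete and k: "halfspace k" "k \<noteq> {}" "k \<noteq> M" and r: "r > 0"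
    and gap: "\<forall>a\<in>M - k. \<forall>b\<in>k. r < d a b" and ss: "strongly_separated (M - k) k"
  shows "\<exists>p q. bridge k p q"
proof -
  have kM: "k \<subseteq> M" by (rule halfspace_subset[OF k(1)])
  have kk: "M - (M - k) = k" using kM by (simp add: double_diff)
  have sym: "strongly_separated k (M - k)"
  proof -
    note S = ss[unfolded strongly_separated_def]
    have "k \<inter> (M - k) = {}" by blast
    then show ?thesis
      unfolding strongly_separated_def
      using S[THEN conjunct1] S[THEN conjunct2, THEN conjunct1]
        S[THEN conjunct2, THEN conjunct2, THEN conjunct2] by blast
  qed
  obtain p where p: "p \<in> k" "\<forall>a\<in>M - k. \<forall>z\<in>k. p \<in> interval a z"
    using halfspace_gate[OF comp k r gap sym] by (rule bexE)
  have ne: "M - k \<noteq> {}" "M - k \<noteq> M" using k(2,3) kM by auto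
  have gap': "\<forall>a\<in>M - (M - k). \<forall>b\<in>M - k. r < d a b"
    unfolding kk
  proof (intro ballI)
    fix a b assume "a \<in> k" "b \<in> M - k"
    then have "r < d b a" using gap by simp
    then show "r < d a b" by (subst commute)
  qed
  have "\<exists>u\<in>M - k. \<forall>a\<in>M - (M - k). \<forall>z\<in>M - k. u \<in> interval a z"
    by (rule halfspace_gate[OF comp halfspace_compl[OF k(1)] ne r gap']) (simp add: kk ss)
  then obtain q where q: "q \<in> M - k" "\<forall>a\<in>k. \<forall>z\<in>M - k. q \<in> interval a z"
    unfolding kk by (rule bexE)
  have "d z z' = d z p + d p q + d q z'" if "z \<in> k" "z' \<in> M - k" for z z'
  proof -
    have "p \<in> interval z' z" by (rule bspec[OF bspec[OF p(2) that(2)] that(1)])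
    moreover have "q \<in> interval p z'" by (rule bspec[OF bspec[OF q(2) p(1)] that(2)])
    ultimately have "d z' z = d z' p + d p z" "d p z' = d p q + d q z'"
      by (simp_all add: interval_def)
    then show ?thesis using commute[of z z'] commute[of z' p] commute[of p z] by linarith
  qed
  then have "bridge k p q" unfolding bridge_def using kM p(1) q(1) by (intro conjI ballI)
  then show ?thesis by (intro exI)
qed

section \<open>Regular points\<close>

lemma roller_coordinate:
  assumes x: "x \<in> roller" and "a \<in> M" "b \<in> M"
  shows "x (a, b) \<in> interval a b"
proof -
  have "x \<in> topspace roller_product"
    using x closure_of_subset_topspace[of roller_product] unfolding roller_def by (rule rev_subsetD)
  then have "x \<in> (\<Pi>\<^sub>E p\<in>M \<times> M. case p of (a, b) \<Rightarrow> interval a b)" by (simp only: topspace_roller_product)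
  then have "x (a, b) \<in> (case (a, b) of (a, b) \<Rightarrow> interval a b)"
    by (rule PiE_mem) (use assms in simp)
  then show ?thesis by simp
qed

lemma roller_extensional:
  assumes "x \<in> roller" shows "x \<in> extensional (M \<times> M)"
proof -
  have "x \<in> topspace roller_product"
    using assms closure_of_subset_topspace[of roller_product] unfolding roller_def by (rule rev_subsetD)
  then show ?thesis by (simp add: topspace_roller_product PiE_def)
qed

lemma roller_eqI:
  assumes "x \<in> roller" "y \<in> roller" and "\<And>a b. \<lbrakk>a \<in> M; b \<in> M\<rbrakk> \<Longrightarrow> x (a, b) = y (a, b)"
  shows "x = y"
  by (rule extensionalityI[OF roller_extensional[OF assms(1)] roller_extensional[OF assms(2)]])
    (use assms(3) in auto)

lemma roller_open_coordinate:
  assumes x: "x \<in> roller" and M: "a \<in> M" "b \<in> M" and "\<epsilon> > 0"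
  obtains T where "openin roller_product T" "x \<in> T" "\<And>y. y \<in> T \<Longrightarrow> d (x (a, b)) (y (a, b)) < \<epsilon>"
proof
  let ?Y = "subtopology mtopology (interval a b)"
  let ?B = "interval a b \<inter> mball (x (a, b)) \<epsilon>"
  let ?T = "{y \<in> topspace roller_product. y (a, b) \<in> ?B}"
  have xi: "x (a, b) \<in> interval a b" by (rule roller_coordinate[OF x M])
  have cont: "continuous_map roller_product ?Y (\<lambda>y. y (a, b))"
    using continuous_map_product_projection[of "(a, b)" "M \<times> M"
        "\<lambda>(a, b). subtopology mtopology (interval a b)"] M
    by (simp add: roller_product_def)
  have "openin ?Y ?B" by (intro openin_subtopology_Int2 openin_mball)
  then show "openin roller_product ?T" by (rule openin_continuous_map_preimage[OF cont])
  have "x \<in> topspace roller_product"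
    using x closure_of_subset_topspace[of roller_product] unfolding roller_def by (rule rev_subsetD)
  then show "x \<in> ?T" using xi interval_subset[OF xi] \<open>\<epsilon> > 0\<close> by simp
  show "d (x (a, b)) (y (a, b)) < \<epsilon>" if "y \<in> ?T" for y using that by simp
qed

text \<open>Two coordinates at once are needed: in \<open>deep_chain_coordinate\<close>, one coordinate forces the
approximating point \<open>z\<close> into a deep halfspace while the other is being computed.\<close>

lemma roller_approx:
  assumes x: "x \<in> roller" and M: "a \<in> M" "b \<in> M" "a' \<in> M" "b' \<in> M" and "\<epsilon> > 0"
  obtains z where "z \<in> M" "d (x (a, b)) (med z a b) < \<epsilon>" "d (x (a', b')) (med z a' b') < \<epsilon>"
proof -
  obtain T where T: "openin roller_product T" "x \<in> T" "\<And>y. y \<in> T \<Longrightarrow> d (x (a, b)) (y (a, b)) < \<epsilon>"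
    using roller_open_coordinate[OF x M(1,2) \<open>\<epsilon> > 0\<close>] by metis
  obtain S where S: "openin roller_product S" "x \<in> S" "\<And>y. y \<in> S \<Longrightarrow> d (x (a', b')) (y (a', b')) < \<epsilon>"
    using roller_open_coordinate[OF x M(3,4) \<open>\<epsilon> > 0\<close>] by metis
  have "openin roller_product (T \<inter> S)" "x \<in> T \<inter> S" using T S by auto
  then have "\<exists>y. y \<in> roller_embed ` M \<and> y \<in> T \<inter> S"
    using x unfolding roller_def in_closure_of by meson
  then obtain y where y: "y \<in> roller_embed ` M" "y \<in> T" "y \<in> S" by auto
  then obtain z where z: "z \<in> M" "y = roller_embed z" by auto
  have "y (a, b) = med z a b" "y (a', b') = med z a' b'" using z M by (simp_all add: roller_embed_def)
  then show ?thesis using that[OF z(1)] T(3)[OF y(2)] S(3)[OF y(3)] by simp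
qed

lemma roller_halfspace_coordinate:
  assumes x: "x \<in> roller" and h: "halfspace h" and xh: "x \<in> roller_halfspace h"
    and a: "a \<in> h" and b: "b \<in> M - h"
  shows "x (a, b) \<in> h"
proof -
  have M: "a \<in> M" "b \<in> M" using a b halfspace_subset[OF h] by auto
  have "\<forall>a\<in>h. \<forall>b\<in>M - h. roller_med x (roller_embed a) (roller_embed b) \<in> roller_embed ` h"
    using xh by (simp add: roller_halfspace_def)
  then have "roller_med x (roller_embed a) (roller_embed b) \<in> roller_embed ` h"
    using a b by blast
  then obtain c where c: "c \<in> h" "roller_med x (roller_embed a) (roller_embed b) = roller_embed c"
    by (rule imageE)
  have cM: "c \<in> M" using c(1) halfspace_subset[OF h] by auto
  have xi: "x (a, b) \<in> interval a b" "x (a, b) \<in> M"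
    using roller_coordinate[OF x M] interval_subset by auto
  have "roller_med x (roller_embed a) (roller_embed b) (a, b) = med (x (a, b)) (med a a b) (med b a b)"
    using M by (simp add: roller_med_def roller_embed_def)
  also have "med a a b = a" using M by (intro med_eqI) (auto simp: interval_ends)
  also have "med b a b = b" using M by (intro med_eqI) (auto simp: interval_ends)
  also have "med (x (a, b)) a b = x (a, b)"
    using M xi by (intro med_eqI) (auto simp: interval_ends)
  finally have "roller_embed c (a, b) = x (a, b)" using c(2) by simp
  moreover have "roller_embed c (a, b) = med c a b" using M by (simp add: roller_embed_def)
  ultimately have "x (a, b) = med c a b" by simp
  then show ?thesis using halfspace_med[OF h cM M] c(1) a by simp
qed

text \<open>The chains of halfspaces in the definition of a regular point, keeping from
the condition on the infimum only the bound that it gives for the individual distances.\<close>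

definition deep_chain :: "(nat \<Rightarrow> 'a set) \<Rightarrow> real \<Rightarrow> bool" where
  "deep_chain h r \<longleftrightarrow> r > 0 \<and> (\<forall>i. halfspace (h i) \<and> h i \<noteq> {} \<and> h i \<noteq> M \<and> h (Suc i) \<subseteq> h i
     \<and> strongly_separated (M - h i) (h (Suc i)) \<and> (\<forall>a\<in>M - h i. \<forall>b\<in>h (Suc i). r < d a b))"

lemma deep_chainD:
  assumes "deep_chain h r"
  shows "r > 0" "halfspace (h i)" "h i \<noteq> {}" "h i \<noteq> M" "h (Suc i) \<subseteq> h i"
    "strongly_separated (M - h i) (h (Suc i))"
    "\<And>a b. \<lbrakk>a \<in> M - h i; b \<in> h (Suc i)\<rbrakk> \<Longrightarrow> r < d a b"
  using assms unfolding deep_chain_def by blast+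

lemma deep_chain_mono:
  assumes "deep_chain h r" "m \<le> n" shows "h n \<subseteq> h m"
  using lift_Suc_antimono_le[of h m n] deep_chainD(5)[OF assms(1)] assms(2) by blast

lemma regular_point_deep_chain:
  assumes "regular_point x"
  shows "x \<in> roller" "\<exists>h r. deep_chain h r \<and> (\<forall>i. x \<in> roller_halfspace (h i))"
proof -
  obtain h :: "nat \<Rightarrow> 'a set" and r where r: "r > 0" and
    H: "\<forall>i. halfspace (h i) \<and> h i \<noteq> {} \<and> h i \<noteq> M \<and> x \<in> roller_halfspace (h i)
            \<and> h (Suc i) \<subseteq> h i
            \<and> strongly_separated (M - h i) (h (Suc i))
            \<and> Inf {d a b |a b. a \<in> M - h i \<and> b \<in> h (Suc i)} > r"
    using assms unfolding regular_point_def by (elim conjE exE)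
  show "x \<in> roller" using assms by (simp add: regular_point_def roller_boundary_def)
  have gap: "r < d a b" if "a \<in> M - h i" "b \<in> h (Suc i)" for a b i
  proof -
    let ?S = "{d a b |a b. a \<in> M - h i \<and> b \<in> h (Suc i)}"
    have "r < Inf ?S" using H by blast
    also have "Inf ?S \<le> d a b"
      using that by (intro cInf_lower bdd_belowI[of _ 0]) auto
    finally show ?thesis .
  qed
  have "deep_chain h r" unfolding deep_chain_def
  proof (intro conjI allI ballI r)
    fix i
    show "halfspace (h i)" "h i \<noteq> {}" "h i \<noteq> M" "h (Suc i) \<subseteq> h i"
      "strongly_separated (M - h i) (h (Suc i))" using H[rule_format, of i] by blast+
    show "r < d a b" if "a \<in> M - h i" "b \<in> h (Suc i)" for a b by (rule gap[OF that])
  qed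
  moreover have "\<forall>i. x \<in> roller_halfspace (h i)" using H by blast
  ultimately show "\<exists>h r. deep_chain h r \<and> (\<forall>i. x \<in> roller_halfspace (h i))" by blast
qed

text \<open>A repetition in a chain makes \<open>h n\<close> strongly separated from its own complement.\<close>

lemma deep_chain_isolated:
  assumes mcomplete and h: "deep_chain h r" and eq: "h (Suc n) = h n"
  shows "\<exists>p q. bridge (h n) p q"
proof (rule bridge_of_isolated_halfspace[OF assms(1) deep_chainD(2-4)[OF h] deep_chainD(1)[OF h]])
  show "\<forall>a\<in>M - h n. \<forall>b\<in>h n. r < d a b" using deep_chainD(7)[OF h, of _ n] eq by simp
  show "strongly_separated (M - h n) (h n)" using deep_chainD(6)[OF h, of n] eq by simp
qed

text \<open>A point in all members of the chain would be infinitely far from the complement of \<open>h 0\<close>. Each pair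
of steps contributes at least \<open>r\<close>: by strictness the way from \<open>c\<close> to a point of \<open>h (2 * n + 2)\<close> passes
through a point \<open>t\<close> of \<open>h (2 * n)\<close> outside \<open>h (2 * n + 1)\<close>. Two steps are needed since \<open>t\<close> must lie in one
member for the induction hypothesis and outside a later one for the gap.\<close>

lemma deep_chain_escape:
  assumes h: "deep_chain h r" and strict: "\<And>n. h (Suc n) \<noteq> h n" and a: "a \<in> M"
  shows "eventually (\<lambda>n. a \<notin> h n) sequentially"
proof -
  note D = deep_chainD[OF h]
  have hM: "h i \<subseteq> M" for i by (rule halfspace_subset[OF D(2)])
  obtain c where c: "c \<in> M" "c \<notin> h 0" using D(4)[of 0] hM[of 0] by blast
  have ch: "c \<notin> h i" for i using c(2) deep_chain_mono[OF h, of 0 i] by auto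
  have far: "real n * r \<le> d c x" if "x \<in> h (2 * n)" for n x
    using that
  proof (induction n arbitrary: x)
    case (Suc n)
    have "h (Suc (2 * n)) \<subset> h (2 * n)" using D(5)[of "2 * n"] strict[of "2 * n"] by blast
    then obtain s where s: "s \<in> h (2 * n)" "s \<notin> h (Suc (2 * n))" by blast
    have x: "x \<in> h (Suc (Suc (2 * n)))" using Suc.prems by simp
    have x': "x \<in> h (2 * n)" using x D(5)[of "Suc (2 * n)"] D(5)[of "2 * n"] by blast
    have M: "s \<in> M" "x \<in> M" using s(1) x' hM by auto
    define t where "t = med c s x"
    have t: "t \<in> interval c x" "t \<in> M"
      using med_in_interval[OF c(1) M] med_closed[OF c(1) M] by (simp_all add: t_def)
    have "t \<in> h (2 * n)" using halfspace_med[OF D(2) c(1) M] s(1) x' by (simp add: t_def)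
    then have "real n * r \<le> d c t" by (rule Suc.IH)
    moreover have "t \<notin> h (Suc (2 * n))"
      using halfspace_med[OF D(2) c(1) M, of "Suc (2 * n)"] s(2) ch[of "Suc (2 * n)"]
      by (simp add: t_def)
    then have "r < d t x" using D(7)[of t "Suc (2 * n)" x] t(2) x by simp
    moreover have "d c x = d c t + d t x" using t(1) by (simp add: interval_def)
    ultimately show ?case by (simp add: algebra_simps)
  qed simp
  obtain n where n: "d c a < real n * r" using reals_Archimedean3[OF D(1)] by blast
  then have out: "a \<notin> h (2 * n)" using far[of a n] by auto
  have "a \<notin> h m" if "2 * n \<le> m" for m using out deep_chain_mono[OF h that] by blast
  then show ?thesis unfolding eventually_sequentially by blast
qed

text \<open>A point of \<open>M\<close> approximating \<open>x\<close> well enough in a coordinate that sees the chain lies in \<open>h (Suc n)\<close>,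
where the median with \<open>a\<close> and \<open>b\<close> is constant by strong separation.\<close>

lemma deep_chain_coordinate:
  assumes x: "x \<in> roller" and h: "deep_chain h r" and xh: "\<And>i. x \<in> roller_halfspace (h i)"
    and a: "a \<in> M - h n" and b: "b \<in> M - h n" and z: "z \<in> h (Suc n)"
  shows "x (a, b) = med z a b"
proof (rule ccontr)
  assume ne: "x (a, b) \<noteq> med z a b"
  note D = deep_chainD[OF h]
  have hM: "h i \<subseteq> M" for i by (rule halfspace_subset[OF D(2)])
  have M: "a \<in> M" "b \<in> M" "z \<in> M" using a b z hM by auto
  have xM: "x (a, b) \<in> M" using roller_coordinate[OF x M(1,2)] by (rule interval_subset)
  have mM: "med z a b \<in> M" by (rule med_closed[OF M(3,1,2)])
  obtain a' where a': "a' \<in> h (Suc (Suc n))" using D(3) by blast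
  obtain b' where b': "b' \<in> M - h (Suc n)" using D(4)[of "Suc n"] hM[of "Suc n"] by blast
  have M': "a' \<in> M" "b' \<in> M" using a' b' hM by auto
  have b2: "b' \<in> M - h (Suc (Suc n))" using b' D(5)[of "Suc n"] by blast
  have deep: "x (a', b') \<in> h (Suc (Suc n))"
    by (rule roller_halfspace_coordinate[OF x D(2) xh a' b2])
  \<comment> \<open>the first bound forces the approximating point into \<open>h (Suc n)\<close>, the second contradicts \<open>ne\<close>\<close>
  define \<epsilon> where "\<epsilon> = min r (d (x (a, b)) (med z a b))"
  have "d (x (a, b)) (med z a b) > 0" using ne xM mM by simp
  then have "\<epsilon> > 0" using D(1) by (simp add: \<epsilon>_def)
  then obtain y where y: "y \<in> M" "d (x (a, b)) (med y a b) < \<epsilon>" "d (x (a', b')) (med y a' b') < \<epsilon>"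
    by (rule roller_approx[OF x M(1,2) M'])
  have m'M: "med y a' b' \<in> M" by (rule med_closed[OF y(1) M'])
  have "med y a' b' \<in> h (Suc n)"
  proof (rule ccontr)
    assume "med y a' b' \<notin> h (Suc n)"
    then have "r < d (med y a' b') (x (a', b'))" using D(7)[OF _ deep] m'M by simp
    then show False using y(3) commute[of "x (a', b')"] by (simp add: \<epsilon>_def)
  qed
  then have "y \<in> h (Suc n)" using halfspace_med[OF D(2) y(1) M'] b' by simp
  then have "med y a b = med z a b"
    by (rule strongly_separated_med[OF D(2) D(6) a b _ z])
  then show False using y(2) by (simp add: \<epsilon>_def)
qed

text \<open>Strict chains, which determine the point \<open>x\<close> of the boundary, as opposed to chains with a
repetition, which produce a bridge instead.\<close>

definition escaping_chain :: "('a \<times> 'a \<Rightarrow> 'a) \<Rightarrow> (nat \<Rightarrow> 'a set) \<Rightarrow> real \<Rightarrow> bool" where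
  "escaping_chain x h r \<longleftrightarrow> x \<in> roller \<and> deep_chain h r \<and> (\<forall>i. x \<in> roller_halfspace (h i))
     \<and> (\<forall>n. h (Suc n) \<noteq> h n)"

lemma escaping_chainD:
  assumes "escaping_chain x h r"
  shows "x \<in> roller" "deep_chain h r" "x \<in> roller_halfspace (h i)" "h (Suc i) \<noteq> h i"
  using assms by (simp_all add: escaping_chain_def)

lemma escaping_chain_escape:
  "\<lbrakk>escaping_chain x h r; a \<in> M\<rbrakk> \<Longrightarrow> eventually (\<lambda>n. a \<notin> h n) sequentially"
  by (rule deep_chain_escape[OF escaping_chainD(2) escaping_chainD(4)])

lemma escaping_chain_coordinate:
  "\<lbrakk>escaping_chain x h r; a \<in> M - h n; b \<in> M - h n; z \<in> h (Suc n)\<rbrakk> \<Longrightarrow> x (a, b) = med z a b"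
  by (rule deep_chain_coordinate[OF escaping_chainD(1-3)])

text \<open>If the two chains met at every level, common points deep in both would compute every coordinate
of both \<open>x\<close> and \<open>x'\<close>.\<close>

lemma escaping_chain_disjoint:
  assumes h: "escaping_chain x h r" and h': "escaping_chain x' h' r'" and ne: "x \<noteq> x'"
  shows "eventually (\<lambda>n. h n \<inter> h' n = {}) sequentially"
proof (rule ccontr)
  assume neg: "\<not> ?thesis"
  \<comment> \<open>the chains decrease, so disjointness at one level would persist\<close>
  have meet: "h n \<inter> h' n \<noteq> {}" for n
  proof
    assume disj: "h n \<inter> h' n = {}"
    have "h m \<inter> h' m = {}" if "n \<le> m" for m
      using disj deep_chain_mono[OF escaping_chainD(2)[OF h] that]
        deep_chain_mono[OF escaping_chainD(2)[OF h'] that] by blast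
    then show False using neg unfolding eventually_sequentially by blast
  qed
  have "x (a, b) = x' (a, b)" if M: "a \<in> M" "b \<in> M" for a b
  proof -
    have "eventually (\<lambda>n. a \<notin> h n \<and> b \<notin> h n \<and> a \<notin> h' n \<and> b \<notin> h' n) sequentially"
      by (intro eventually_conj escaping_chain_escape[OF h] escaping_chain_escape[OF h'] M)
    from eventually_happens'[OF sequentially_bot this]
    obtain n where "a \<notin> h n" "b \<notin> h n" "a \<notin> h' n" "b \<notin> h' n" by auto
    then have out: "a \<in> M - h n" "b \<in> M - h n" "a \<in> M - h' n" "b \<in> M - h' n" using M by auto
    obtain z where z: "z \<in> h (Suc n)" "z \<in> h' (Suc n)" using meet[of "Suc n"] by blast
    have "x (a, b) = med z a b" by (rule escaping_chain_coordinate[OF h out(1,2) z(1)])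
    also have "\<dots> = x' (a, b)" by (rule escaping_chain_coordinate[OF h' out(3,4) z(2), symmetric])
    finally show ?thesis .
  qed
  then have "x = x'" by (rule roller_eqI[OF escaping_chainD(1)[OF h] escaping_chainD(1)[OF h']])
  then show False using ne by contradiction
qed

lemma deep_chain_pick:
  assumes "deep_chain h r" obtains z where "z \<in> h n"
  using deep_chainD(3)[OF assms, of n] by auto

lemma deep_chain_mball:
  assumes h: "deep_chain h r" and a: "a \<in> h (Suc n)"
  shows "mball a r \<subseteq> h n"
proof
  fix y assume y: "y \<in> mball a r"
  show "y \<in> h n"
  proof (rule ccontr)
    assume "y \<notin> h n"
    then have "r < d y a" using deep_chainD(7)[OF h _ a] y by simp
    then show False using y commute[of a y] by simp
  qed
qed

text \<open>Beyond a level \<open>N\<close> where the three chains are pairwise disjoint, the median \<open>p'\<close> of points of the three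
members is independent of these points. To compare it with \<open>p\<close>, look at the coordinate given by the
pair of \<open>p\<close> and \<open>p'\<close> and choose points \<open>w1\<close>, \<open>w2\<close>, \<open>w3\<close> so deep that they compute it; a halfspace
containing \<open>p'\<close> but not \<open>p\<close> is refuted by majority vote.\<close>

lemma stable_median_of_chains:
  assumes h1: "escaping_chain x1 h1 r1" and h2: "escaping_chain x2 h2 r2"
    and h3: "escaping_chain x3 h3 r3" and ne: "x1 \<noteq> x2" "x1 \<noteq> x3" "x2 \<noteq> x3"
    and p: "p \<in> M" "roller_embed p = roller_med x1 x2 x3"
  shows "p \<in> stable_medians"
proof -
  note D = escaping_chainD(2)[OF h1] escaping_chainD(2)[OF h2] escaping_chainD(2)[OF h3]
  have hM: "h1 i \<subseteq> M" "h2 i \<subseteq> M" "h3 i \<subseteq> M" for i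
    by (rule halfspace_subset[OF deep_chainD(2)] D)+
  have "eventually (\<lambda>n. h1 n \<inter> h2 n = {} \<and> h1 n \<inter> h3 n = {} \<and> h2 n \<inter> h3 n = {}) sequentially"
    by (intro eventually_conj escaping_chain_disjoint[OF h1 h2 ne(1)]
        escaping_chain_disjoint[OF h1 h3 ne(2)] escaping_chain_disjoint[OF h2 h3 ne(3)])
  from eventually_happens'[OF sequentially_bot this]
  obtain N where N: "h1 N \<inter> h2 N = {}" "h1 N \<inter> h3 N = {}" "h2 N \<inter> h3 N = {}" by auto
  have const: "med y1 y2 y3 = med z1 z2 z3"
    if y: "y1 \<in> h1 (Suc N)" "y2 \<in> h2 (Suc N)" "y3 \<in> h3 (Suc N)"
      and z: "z1 \<in> h1 (Suc N)" "z2 \<in> h2 (Suc N)" "z3 \<in> h3 (Suc N)" for y1 y2 y3 z1 z2 z3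
  proof -
    have yM: "y1 \<in> M" "y2 \<in> M" "y3 \<in> M" and zM: "z1 \<in> M" "z2 \<in> M" "z3 \<in> M"
      by (rule subsetD[OF hM(1) y(1)] subsetD[OF hM(2) y(2)] subsetD[OF hM(3) y(3)]
          subsetD[OF hM(1) z(1)] subsetD[OF hM(2) z(2)] subsetD[OF hM(3) z(3)])+
    have "z1 \<in> h1 N" "y2 \<in> h2 N" "z2 \<in> h2 N" "y3 \<in> h3 N"
      by (rule subsetD[OF deep_chainD(5)[OF D(1)] z(1)] subsetD[OF deep_chainD(5)[OF D(2)] y(2)]
          subsetD[OF deep_chainD(5)[OF D(2)] z(2)] subsetD[OF deep_chainD(5)[OF D(3)] y(3)])+
    then have out: "z1 \<in> M - h2 N" "z1 \<in> M - h3 N" "y2 \<in> M - h1 N" "z2 \<in> M - h3 N"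
      "y3 \<in> M - h1 N" "y3 \<in> M - h2 N"
      using yM zM N by (simp_all add: disjoint_iff) blast+
    have "med y1 y2 y3 = med z1 y2 y3"
      by (rule strongly_separated_med[OF deep_chainD(2,6)[OF D(1)] out(3,5) y(1) z(1)])
    also have "\<dots> = med y2 z1 y3" by (rule med_perm(1)[OF yM(2) zM(1) yM(3)])
    also have "\<dots> = med z2 z1 y3"
      by (rule strongly_separated_med[OF deep_chainD(2,6)[OF D(2)] out(1,6) y(2) z(2)])
    also have "\<dots> = med z2 y3 z1" by (rule med_perm(2)[OF zM(2) yM(3) zM(1)])
    also have "\<dots> = med y3 z2 z1" by (rule med_perm(1)[OF yM(3) zM(2) zM(1)])
    also have "\<dots> = med z3 z2 z1"
      by (rule strongly_separated_med[OF deep_chainD(2,6)[OF D(3)] out(4,2) y(3) z(3)])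
    also have "\<dots> = med z2 z3 z1" by (rule med_perm(1)[OF zM(2,3,1)])
    also have "\<dots> = med z2 z1 z3" by (rule med_perm(2)[OF zM(2,1,3)])
    also have "\<dots> = med z1 z2 z3" by (rule med_perm(1)[OF zM])
    finally show ?thesis .
  qed
  obtain z1 where z1: "z1 \<in> h1 (Suc N)" by (rule deep_chain_pick[OF D(1)])
  obtain z2 where z2: "z2 \<in> h2 (Suc N)" by (rule deep_chain_pick[OF D(2)])
  obtain z3 where z3: "z3 \<in> h3 (Suc N)" by (rule deep_chain_pick[OF D(3)])
  note z = z1 z2 z3
  define p' where "p' = med z1 z2 z3"
  have zM: "z1 \<in> M" "z2 \<in> M" "z3 \<in> M"
    by (rule subsetD[OF hM(1) z(1)] subsetD[OF hM(2) z(2)] subsetD[OF hM(3) z(3)])+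
  have p'M: "p' \<in> M" unfolding p'_def by (rule med_closed[OF zM])
  have "p = p'"
  proof (rule ccontr)
    assume "p \<noteq> p'"
    then obtain j where j: "halfspace j" "p' \<in> j" "p \<notin> j"
      by (rule separating_halfspace[OF p(1) p'M])
    have "eventually (\<lambda>n. p \<notin> h1 n \<and> p' \<notin> h1 n \<and> p \<notin> h2 n \<and> p' \<notin> h2 n \<and> p \<notin> h3 n \<and> p' \<notin> h3 n
        \<and> N \<le> n) sequentially"
      by (intro eventually_conj escaping_chain_escape[OF h1] escaping_chain_escape[OF h2]
          escaping_chain_escape[OF h3] p(1) p'M eventually_ge_at_top)
    from eventually_happens'[OF sequentially_bot this]
    obtain n where n: "p \<notin> h1 n" "p' \<notin> h1 n" "p \<notin> h2 n" "p' \<notin> h2 n" "p \<notin> h3 n" "p' \<notin> h3 n"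
      "N \<le> n" by auto
    obtain w1 where w1: "w1 \<in> h1 (Suc n)" by (rule deep_chain_pick[OF D(1)])
    obtain w2 where w2: "w2 \<in> h2 (Suc n)" by (rule deep_chain_pick[OF D(2)])
    obtain w3 where w3: "w3 \<in> h3 (Suc n)" by (rule deep_chain_pick[OF D(3)])
    note w = w1 w2 w3
    have wM: "w1 \<in> M" "w2 \<in> M" "w3 \<in> M"
    by (rule subsetD[OF hM(1) w(1)] subsetD[OF hM(2) w(2)] subsetD[OF hM(3) w(3)])+
    have le: "Suc N \<le> Suc n" using n(7) by simp
    have "w1 \<in> h1 (Suc N)" "w2 \<in> h2 (Suc N)" "w3 \<in> h3 (Suc N)"
      by (rule subsetD[OF deep_chain_mono[OF D(1) le] w1] subsetD[OF deep_chain_mono[OF D(2) le] w2]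
          subsetD[OF deep_chain_mono[OF D(3) le] w3])+
    then have p'w: "p' = med w1 w2 w3" unfolding p'_def by (rule const[OF z])
    have coord: "x1 (p, p') = med w1 p p'" "x2 (p, p') = med w2 p p'" "x3 (p, p') = med w3 p p'"
      using p(1) p'M n w by (auto intro!: escaping_chain_coordinate[OF h1, of _ n]
          escaping_chain_coordinate[OF h2, of _ n] escaping_chain_coordinate[OF h3, of _ n])
    have "roller_embed p (p, p') = roller_med x1 x2 x3 (p, p')" using p(2) by simp
    then have pw: "med p p p' = med (med w1 p p') (med w2 p p') (med w3 p p')"
      using p(1) p'M coord by (simp add: roller_embed_def roller_med_def)
    have "med p p p' \<in> j \<longleftrightarrow> med w1 w2 w3 \<in> j"
      unfolding pw using j(2,3) p(1) p'M wM
      by (simp add: halfspace_med[OF j(1)] med_closed)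
    then show False
      using j(2,3) halfspace_med[OF j(1) p(1) p(1) p'M] unfolding p'w[symmetric] by blast
  qed
  \<comment> \<open>one level deeper than \<open>const\<close> needs: the gap of the chain leaves room for a ball\<close>
  obtain a1 where a1: "a1 \<in> h1 (Suc (Suc N))" by (rule deep_chain_pick[OF D(1)])
  obtain a2 where a2: "a2 \<in> h2 (Suc (Suc N))" by (rule deep_chain_pick[OF D(2)])
  obtain a3 where a3: "a3 \<in> h3 (Suc (Suc N))" by (rule deep_chain_pick[OF D(3)])
  note a = a1 a2 a3
  define r where "r = min r1 (min r2 r3)"
  have r: "r > 0" using deep_chainD(1)[OF D(1)] deep_chainD(1)[OF D(2)] deep_chainD(1)[OF D(3)]
    by (simp add: r_def)
  have balls: "mball a1 r \<subseteq> h1 (Suc N)" "mball a2 r \<subseteq> h2 (Suc N)" "mball a3 r \<subseteq> h3 (Suc N)"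
  proof -
    have "mball a1 r \<subseteq> mball a1 r1" "mball a2 r \<subseteq> mball a2 r2" "mball a3 r \<subseteq> mball a3 r3"
      by (auto simp: r_def)
    then show "mball a1 r \<subseteq> h1 (Suc N)" "mball a2 r \<subseteq> h2 (Suc N)" "mball a3 r \<subseteq> h3 (Suc N)"
      using deep_chain_mball[OF D(1) a(1)] deep_chain_mball[OF D(2) a(2)]
        deep_chain_mball[OF D(3) a(3)] by blast+
  qed
  have aM: "a1 \<in> M" "a2 \<in> M" "a3 \<in> M"
    by (rule subsetD[OF hM(1) a(1)] subsetD[OF hM(2) a(2)] subsetD[OF hM(3) a(3)])+
  show ?thesis
    unfolding stable_medians_def
  proof (rule CollectI, rule bexI[OF _ aM(1)], rule bexI[OF _ aM(2)], rule bexI[OF _ aM(3)],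
      intro exI[of _ r] conjI ballI r)
    fix y1 y2 y3 assume y: "y1 \<in> mball a1 r" "y2 \<in> mball a2 r" "y3 \<in> mball a3 r"
    have "y1 \<in> h1 (Suc N)" "y2 \<in> h2 (Suc N)" "y3 \<in> h3 (Suc N)"
      by (rule subsetD[OF balls(1) y(1)] subsetD[OF balls(2) y(2)] subsetD[OF balls(3) y(3)])+
    then have "med y1 y2 y3 = p'" unfolding p'_def by (rule const[OF _ _ _ z])
    then show "med y1 y2 y3 = p" using \<open>p = p'\<close> by simp
  qed
qed

lemma anchors_nonempty:
  assumes comp: mcomplete and p: "p \<in> core_stage 0"
  shows "anchors \<noteq> {}"
proof
  assume empty: "anchors = {}"
  have chain: "\<exists>h r. escaping_chain x h r" if "x \<in> regular_boundary" for x
  proof -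
    have x: "regular_point x" using that by (simp add: regular_boundary_def)
    obtain h r where h: "deep_chain h r" "\<forall>i. x \<in> roller_halfspace (h i)"
      using regular_point_deep_chain(2)[OF x] by blast
    have "h (Suc n) \<noteq> h n" for n
      using deep_chain_isolated[OF comp h(1), of n] empty by (auto simp: anchors_def)
    then have "escaping_chain x h r"
      unfolding escaping_chain_def using h regular_point_deep_chain(1)[OF x] by blast
    then show ?thesis by blast
  qed
  obtain x1 x2 x3 where x: "x1 \<in> regular_boundary" "x2 \<in> regular_boundary" "x3 \<in> regular_boundary"
    "x1 \<noteq> x2" "x1 \<noteq> x3" "x2 \<noteq> x3" "roller_embed p = roller_med x1 x2 x3" and pM: "p \<in> M"
    using p by auto
  obtain h1 r1 where h1: "escaping_chain x1 h1 r1" using chain[OF x(1)] by blast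
  obtain h2 r2 where h2: "escaping_chain x2 h2 r2" using chain[OF x(2)] by blast
  obtain h3 r3 where h3: "escaping_chain x3 h3 r3" using chain[OF x(3)] by blast
  have "p \<in> stable_medians" by (rule stable_median_of_chains[OF h1 h2 h3 x(4-6) pM x(7)])
  then show False using empty by (simp add: anchors_def)
qed

lemma median_core_empty:
  assumes "core_stage 0 = {}" shows "median_core = {}"
proof -
  have "core_stage i = {}" for i
    by (induction i) (use assms in \<open>auto simp del: core_stage.simps(1)\<close>)
  then show ?thesis by (simp add: median_core_def del: core_stage.simps)
qed

end

theorem lemma6:
  fixes X :: "'a set" and d :: "'a \<Rightarrow> 'a \<Rightarrow> real"
  assumes "median_space X d"
    and "Metric_space.mcomplete X d"
    and "separable_space (Metric_space.mtopology X d)"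
    and "median_space.irreducible X d"
    and "median_space.rank X d < \<infinity>"
    and "median_space.roller_nonelementary X d (median_space.isom X d)"
    and "median_space.roller_minimal X d (median_space.isom X d)"
  shows "\<exists>H. countable H \<and> (\<forall>h\<in>H. median_space.halfspace X d h)
    \<and> (\<forall>g\<in>median_space.isom X d. (\<lambda>h. g ` h) ` H = H)
    \<and> (\<forall>x\<in>median_space.median_core X d. \<forall>y\<in>median_space.median_core X d.
          x \<noteq> y \<longrightarrow> (\<exists>h\<in>H. separates h x y))"
proof -
  interpret median_space X d by fact
  obtain N where N: "rank \<le> enat N" using assms(5) by (cases rank) auto
  define H where "H = (\<Union>p\<in>anchors. distance_walls p)"
  have "countable H"
    unfolding H_def using countable_anchors[OF assms(3)] countable_distance_walls[OF N assms(3)]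
      anchors_subset by (intro countable_UN) auto
  moreover have "halfspace h" if "h \<in> H" for h
  proof -
    obtain p where "h \<in> distance_walls p" using \<open>h \<in> H\<close> by (auto simp: H_def)
    then show ?thesis unfolding distance_walls_def using maximal_avoidingD(1) by blast
  qed
  moreover have "(\<lambda>h. g ` h) ` H = H" if "g \<in> isom" for g
    unfolding H_def by (rule isom_image_anchor_walls[OF that])
  moreover have "\<exists>h\<in>H. separates h x y" if xy: "x \<in> median_core" "y \<in> median_core" "x \<noteq> y" for x y
  proof -
    have M: "x \<in> X" "y \<in> X"
      using xy closure_of_subset_topspace[of mtopology] unfolding median_core_def by auto
    have "core_stage 0 \<noteq> {}" using median_core_empty xy(1) by auto
    then obtain q where "q \<in> core_stage 0" by blast
    then obtain p where p: "p \<in> anchors" using anchors_nonempty[OF assms(2)] by blast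
    then have "p \<in> X" using anchors_subset by blast
    then show ?thesis
      using distance_walls_separate[OF N _ M xy(3)] p unfolding H_def by blast
  qed
  ultimately show ?thesis by (intro exI[of _ H]) blast
qed

end
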